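(* Let $T$ be a complete affine $L$-theory and $M\vDash T$. If $M$ is compact, then every $p\in E_n(T)$ is realized in $M$. More generally, if $M$ realizes every type in $\mathbb S_n(\mathbb T_M)$, then $M$ realizes every extreme type in $S_n(T)$.
   Context: Affine (linear) continuous logic. A language $L$ consists of constant symbols, function symbols $F$ (each with an arity and a Lipschitz constant $\lambda_F\geqslant0$) and relation symbols $R$ (each with an arity and a Lipschitz constant $\lambda_R\geqslant 0$), always including a distinguished binary relation symbol $d$ for the metric. An $L$-structure is a complete metric space $(M,d)$ with $c^M\in M$, $F^M:M^n\to M$ $\lambda_F$-Lipschitz, and $R^M:M^n\to\mathbb R$ $\lambda_R$-Lipschitz with $\|R^M\|_\infty\leqslant1$ (so $d\leqslant 1$); $M^n$ carries the metric $\sum_{i<n}2^{-i}d(x_i,y_i)$. Affine formulas are generated by $r$, $d(t_1,t_2)$, $R(t_1,\dots,t_n)$, $r\phi$, $\phi+\psi$, $\sup_x\phi$, $\inf_x\phi$ ($r\in\mathbb R$, $t_i$ terms) and are interpreted as real-valued functions $\phi^M$. A condition is an expression $\phi\leqslant\psi$ (and $\phi=\psi$ abbreviates the two inequalities); an (affine) theory is a set of conditions between sentences; $M\vDash T$ means all conditions of $T$ hold in $M$. $T$ is complete if it has a model and for every sentence $\sigma$ there is a unique $r\in\mathbb R$ with $\sigma=r$ in $T$. For complete $T$, $\mathbb D_n(T)$ is the ordered vector space of formulas $\phi(x_1,\dots,x_n)$ modulo $T$-equivalence, i.e. $\{\phi^M\}$ for any $M\vDash T$, with pointwise order and sup-norm.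 An $n$-type is a positive linear functional $p:\mathbb D_n(T)\to\mathbb R$ with $p(1)=1$; $S_n(T)$ is the compact convex set of all $n$-types, and $E_n(T)$ is its set of extreme points, called extreme types. A tuple $\bar a\in M^n$ realizes $p$ if $p(\phi)=\phi^M(\bar a)$ for all $\phi$. CL (full continuous logic) is obtained by additionally allowing $\phi\wedge\psi$ (minimum) and $\phi\vee\psi$ (maximum) as formulas. $\mathbb T_M$ is the complete theory of $M$ in the CL sense, and $\mathbb S_n(\mathbb T_M)$ is its space of complete $n$-types in the CL sense. *)

theory Defs
  imports "HOL-Analysis.Analysis"
begin

(* HOL types are nonempty, so the symbols of a language are given by sets; any of these may be
   empty.  The metric symbol d is not listed: it is the formula constructor FDist, always
   interpreted by the metric of the structure. *)
record ('c, 'f, 'r) lang =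
  consts_of :: "'c set"
  funs_of :: "'f set"
  rels_of :: "'r set"
  fun_ar :: "'f \<Rightarrow> nat"
  fun_lip :: "'f \<Rightarrow> real"
  rel_ar :: "'r \<Rightarrow> nat"
  rel_lip :: "'r \<Rightarrow> real"

definition is_lang :: "('c, 'f, 'r) lang \<Rightarrow> bool" where
  "is_lang L \<longleftrightarrow> (\<forall>F\<in>funs_of L. 0 \<le> fun_lip L F) \<and> (\<forall>R\<in>rels_of L. 0 \<le> rel_lip L R)"

datatype ('c, 'f) tm = TVar nat | TCst 'c | TFun 'f "('c, 'f) tm list"

(* Formulas of full continuous logic CL; the affine formulas are those without FMin and FMax. *)
datatype ('c, 'f, 'r) fm =
    FReal real
  | FDist "('c, 'f) tm" "('c, 'f) tm"
  | FRel 'r "('c, 'f) tm list"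
  | FScale real "('c, 'f, 'r) fm"
  | FAdd "('c, 'f, 'r) fm" "('c, 'f, 'r) fm"
  | FSup nat "('c, 'f, 'r) fm"
  | FInf nat "('c, 'f, 'r) fm"
  | FMin "('c, 'f, 'r) fm" "('c, 'f, 'r) fm"
  | FMax "('c, 'f, 'r) fm" "('c, 'f, 'r) fm"

primrec affine_fm :: "('c, 'f, 'r) fm \<Rightarrow> bool" where
  "affine_fm (FReal r) = True"
| "affine_fm (FDist s t) = True"
| "affine_fm (FRel R ts) = True"
| "affine_fm (FScale r \<phi>) = affine_fm \<phi>"
| "affine_fm (FAdd \<phi> \<psi>) = (affine_fm \<phi> \<and> affine_fm \<psi>)"
| "affine_fm (FSup v \<phi>) = affine_fm \<phi>"
| "affine_fm (FInf v \<phi>) = affine_fm \<phi>"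
| "affine_fm (FMin \<phi> \<psi>) = False"
| "affine_fm (FMax \<phi> \<psi>) = False"

fun tm_in :: "('c, 'f, 'r) lang \<Rightarrow> ('c, 'f) tm \<Rightarrow> bool" where
  "tm_in L (TVar v) = True"
| "tm_in L (TCst c) = (c \<in> consts_of L)"
| "tm_in L (TFun F ts) = (F \<in> funs_of L \<and> length ts = fun_ar L F \<and> (\<forall>t\<in>set ts. tm_in L t))"

primrec fm_in :: "('c, 'f, 'r) lang \<Rightarrow> ('c, 'f, 'r) fm \<Rightarrow> bool" where
  "fm_in L (FReal r) = True"
| "fm_in L (FDist s t) = (tm_in L s \<and> tm_in L t)"
| "fm_in L (FRel R ts) = (R \<in> rels_of L \<and> length ts = rel_ar L R \<and> (\<forall>t\<in>set ts. tm_in L t))"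
| "fm_in L (FScale r \<phi>) = fm_in L \<phi>"
| "fm_in L (FAdd \<phi> \<psi>) = (fm_in L \<phi> \<and> fm_in L \<psi>)"
| "fm_in L (FSup v \<phi>) = fm_in L \<phi>"
| "fm_in L (FInf v \<phi>) = fm_in L \<phi>"
| "fm_in L (FMin \<phi> \<psi>) = (fm_in L \<phi> \<and> fm_in L \<psi>)"
| "fm_in L (FMax \<phi> \<psi>) = (fm_in L \<phi> \<and> fm_in L \<psi>)"

fun tm_vars :: "('c, 'f) tm \<Rightarrow> nat set" where
  "tm_vars (TVar v) = {v}"
| "tm_vars (TCst c) = {}"
| "tm_vars (TFun F ts) = (\<Union>t\<in>set ts. tm_vars t)"

primrec free_vars :: "('c, 'f, 'r) fm \<Rightarrow> nat set" where
  "free_vars (FReal r) = {}"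
| "free_vars (FDist s t) = tm_vars s \<union> tm_vars t"
| "free_vars (FRel R ts) = (\<Union>t\<in>set ts. tm_vars t)"
| "free_vars (FScale r \<phi>) = free_vars \<phi>"
| "free_vars (FAdd \<phi> \<psi>) = free_vars \<phi> \<union> free_vars \<psi>"
| "free_vars (FSup v \<phi>) = free_vars \<phi> - {v}"
| "free_vars (FInf v \<phi>) = free_vars \<phi> - {v}"
| "free_vars (FMin \<phi> \<psi>) = free_vars \<phi> \<union> free_vars \<psi>"
| "free_vars (FMax \<phi> \<psi>) = free_vars \<phi> \<union> free_vars \<psi>"

(* The paper's variables x_1, ..., x_n are the variables 0, ..., n - 1; n = 0 gives sentences. *)
definition cl_fms :: "('c, 'f, 'r) lang \<Rightarrow> nat \<Rightarrow> ('c, 'f, 'r) fm set" where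
  "cl_fms L n = {\<phi>. fm_in L \<phi> \<and> free_vars \<phi> \<subseteq> {..<n}}"

definition affine_fms :: "('c, 'f, 'r) lang \<Rightarrow> nat \<Rightarrow> ('c, 'f, 'r) fm set" where
  "affine_fms L n = {\<phi> \<in> cl_fms L n. affine_fm \<phi>}"

record ('c, 'f, 'r, 'm) struct =
  met :: "'m metric"
  cst_int :: "'c \<Rightarrow> 'm"
  fun_int :: "'f \<Rightarrow> 'm list \<Rightarrow> 'm"
  rel_int :: "'r \<Rightarrow> 'm list \<Rightarrow> real"

definition tuples :: "('c, 'f, 'r, 'm) struct \<Rightarrow> nat \<Rightarrow> 'm list set" where
  "tuples M n = {a. length a = n \<and> set a \<subseteq> mspace (met M)}"

definition tuple_dist :: "('c, 'f, 'r, 'm) struct \<Rightarrow> nat \<Rightarrow> 'm list \<Rightarrow> 'm list \<Rightarrow> real" where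
  "tuple_dist M n a b = (\<Sum>i<n. (1/2) ^ i * mdist (met M) (a ! i) (b ! i))"

(* The metric is automatically 2-Lipschitz for tuple_dist M 2, so d only contributes the bound
   d <= 1. *)
definition is_struct :: "('c, 'f, 'r) lang \<Rightarrow> ('c, 'f, 'r, 'm) struct \<Rightarrow> bool" where
  "is_struct L M \<longleftrightarrow>
     mspace (met M) \<noteq> {} \<and>
     mcomplete_of (met M) \<and>
     (\<forall>x\<in>mspace (met M). \<forall>y\<in>mspace (met M). mdist (met M) x y \<le> 1) \<and>
     (\<forall>c\<in>consts_of L. cst_int M c \<in> mspace (met M)) \<and>
     (\<forall>F\<in>funs_of L.
        (\<forall>a\<in>tuples M (fun_ar L F). fun_int M F a \<in> mspace (met M)) \<and>
        (\<forall>a\<in>tuples M (fun_ar L F). \<forall>b\<in>tuples M (fun_ar L F).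
           mdist (met M) (fun_int M F a) (fun_int M F b)
             \<le> fun_lip L F * tuple_dist M (fun_ar L F) a b)) \<and>
     (\<forall>R\<in>rels_of L.
        (\<forall>a\<in>tuples M (rel_ar L R). \<bar>rel_int M R a\<bar> \<le> 1) \<and>
        (\<forall>a\<in>tuples M (rel_ar L R). \<forall>b\<in>tuples M (rel_ar L R).
           \<bar>rel_int M R a - rel_int M R b\<bar>
             \<le> rel_lip L R * tuple_dist M (rel_ar L R) a b))"

fun tm_val :: "('c, 'f, 'r, 'm) struct \<Rightarrow> (nat \<Rightarrow> 'm) \<Rightarrow> ('c, 'f) tm \<Rightarrow> 'm" where
  "tm_val M e (TVar v) = e v"
| "tm_val M e (TCst c) = cst_int M c"
| "tm_val M e (TFun F ts) = fun_int M F (map (tm_val M e) ts)"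

primrec fm_val :: "('c, 'f, 'r, 'm) struct \<Rightarrow> ('c, 'f, 'r) fm \<Rightarrow> (nat \<Rightarrow> 'm) \<Rightarrow> real" where
  "fm_val M (FReal r) = (\<lambda>e. r)"
| "fm_val M (FDist s t) = (\<lambda>e. mdist (met M) (tm_val M e s) (tm_val M e t))"
| "fm_val M (FRel R ts) = (\<lambda>e. rel_int M R (map (tm_val M e) ts))"
| "fm_val M (FScale r \<phi>) = (\<lambda>e. r * fm_val M \<phi> e)"
| "fm_val M (FAdd \<phi> \<psi>) = (\<lambda>e. fm_val M \<phi> e + fm_val M \<psi> e)"
| "fm_val M (FSup v \<phi>) = (\<lambda>e. SUP x\<in>mspace (met M). fm_val M \<phi> (e(v := x)))"
| "fm_val M (FInf v \<phi>) = (\<lambda>e. INF x\<in>mspace (met M). fm_val M \<phi> (e(v := x)))"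
| "fm_val M (FMin \<phi> \<psi>) = (\<lambda>e. min (fm_val M \<phi> e) (fm_val M \<psi> e))"
| "fm_val M (FMax \<phi> \<psi>) = (\<lambda>e. max (fm_val M \<phi> e) (fm_val M \<psi> e))"

(* For phi in cl_fms L n and a of length n, the values of (!) a at indices >= n are irrelevant. *)
definition val :: "('c, 'f, 'r, 'm) struct \<Rightarrow> ('c, 'f, 'r) fm \<Rightarrow> 'm list \<Rightarrow> real" where
  "val M \<phi> a = fm_val M \<phi> (\<lambda>i. a ! i)"

(* The pair (phi, psi) is the condition phi <= psi. *)
type_synonym ('c, 'f, 'r) cond = "('c, 'f, 'r) fm \<times> ('c, 'f, 'r) fm"

definition affine_theory :: "('c, 'f, 'r) lang \<Rightarrow> ('c, 'f, 'r) cond set \<Rightarrow> bool" where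
  "affine_theory L T \<longleftrightarrow> T \<subseteq> affine_fms L 0 \<times> affine_fms L 0"

definition models ::
    "('c, 'f, 'r) lang \<Rightarrow> ('c, 'f, 'r, 'm) struct \<Rightarrow> ('c, 'f, 'r) cond set \<Rightarrow> bool" where
  "models L M T \<longleftrightarrow> is_struct L M \<and> (\<forall>(\<phi>, \<psi>)\<in>T. val M \<phi> [] \<le> val M \<psi> [])"

(* Consequence, over the models of T whose points lie in the type 'm: HOL cannot quantify over
   all types.  All notions below that depend on it are used with 'm the type of the given model M.
   A theory that is complete in the unrestricted sense and has the model M is complete with
   respect to this consequence relation, which then coincides with the unrestricted one: either
   relation holds exactly when it holds in M. *)
definition entails_le ::
    "'m itself \<Rightarrow> ('c, 'f, 'r) lang \<Rightarrow> ('c, 'f, 'r) cond set \<Rightarrow> nat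
      \<Rightarrow> ('c, 'f, 'r) fm \<Rightarrow> ('c, 'f, 'r) fm \<Rightarrow> bool" where
  "entails_le (_ :: 'm itself) L T n \<phi> \<psi> \<longleftrightarrow>
     (\<forall>N :: ('c, 'f, 'r, 'm) struct. models L N T \<longrightarrow>
        (\<forall>a\<in>tuples N n. val N \<phi> a \<le> val N \<psi> a))"

definition entails_eq ::
    "'m itself \<Rightarrow> ('c, 'f, 'r) lang \<Rightarrow> ('c, 'f, 'r) cond set \<Rightarrow> nat
      \<Rightarrow> ('c, 'f, 'r) fm \<Rightarrow> ('c, 'f, 'r) fm \<Rightarrow> bool" where
  "entails_eq U L T n \<phi> \<psi> \<longleftrightarrow> entails_le U L T n \<phi> \<psi> \<and> entails_le U L T n \<psi> \<phi>"

definition complete_theory ::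
    "'m itself \<Rightarrow> ('c, 'f, 'r) lang \<Rightarrow> ('c, 'f, 'r) cond set \<Rightarrow> bool" where
  "complete_theory (U :: 'm itself) L T \<longleftrightarrow>
     affine_theory L T \<and>
     (\<exists>N :: ('c, 'f, 'r, 'm) struct. models L N T) \<and>
     (\<forall>\<sigma>\<in>affine_fms L 0. \<exists>!r. entails_eq U L T 0 \<sigma> (FReal r))"

definition T_equiv ::
    "'m itself \<Rightarrow> ('c, 'f, 'r) lang \<Rightarrow> ('c, 'f, 'r) cond set \<Rightarrow> nat
      \<Rightarrow> (('c, 'f, 'r) fm \<times> ('c, 'f, 'r) fm) set" where
  "T_equiv U L T n = {(\<phi>, \<psi>) \<in> affine_fms L n \<times> affine_fms L n. entails_eq U L T n \<phi> \<psi>}"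

definition fm_class ::
    "'m itself \<Rightarrow> ('c, 'f, 'r) lang \<Rightarrow> ('c, 'f, 'r) cond set \<Rightarrow> nat
      \<Rightarrow> ('c, 'f, 'r) fm \<Rightarrow> ('c, 'f, 'r) fm set" where
  "fm_class U L T n \<phi> = T_equiv U L T n `` {\<phi>}"

(* The underlying set of D_n(T); addition, scaling and order are those of representatives. *)
definition D_space ::
    "'m itself \<Rightarrow> ('c, 'f, 'r) lang \<Rightarrow> ('c, 'f, 'r) cond set \<Rightarrow> nat
      \<Rightarrow> ('c, 'f, 'r) fm set set" where
  "D_space U L T n = affine_fms L n // T_equiv U L T n"

(* S_n(T): the positive normalized linear functionals on D_n(T), made extensional so that equality
   of HOL functions is equality of functionals. *)
definition affine_types ::
    "'m itself \<Rightarrow> ('c, 'f, 'r) lang \<Rightarrow> ('c, 'f, 'r) cond set \<Rightarrow> nat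
      \<Rightarrow> (('c, 'f, 'r) fm set \<Rightarrow> real) set" where
  "affine_types U L T n =
     {p \<in> extensional (D_space U L T n).
        (\<forall>\<phi>\<in>affine_fms L n. \<forall>\<psi>\<in>affine_fms L n.
           p (fm_class U L T n (FAdd \<phi> \<psi>)) = p (fm_class U L T n \<phi>) + p (fm_class U L T n \<psi>)) \<and>
        (\<forall>r. \<forall>\<phi>\<in>affine_fms L n.
           p (fm_class U L T n (FScale r \<phi>)) = r * p (fm_class U L T n \<phi>)) \<and>
        (\<forall>\<phi>\<in>affine_fms L n. entails_le U L T n (FReal 0) \<phi> \<longrightarrow> 0 \<le> p (fm_class U L T n \<phi>)) \<and>
        p (fm_class U L T n (FReal 1)) = 1}"

(* E_n(T).  The library's extreme_point_of needs a real vector space type, which functions into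
   the reals are not. *)
definition extreme_types ::
    "'m itself \<Rightarrow> ('c, 'f, 'r) lang \<Rightarrow> ('c, 'f, 'r) cond set \<Rightarrow> nat
      \<Rightarrow> (('c, 'f, 'r) fm set \<Rightarrow> real) set" where
  "extreme_types U L T n =
     {p \<in> affine_types U L T n.
        \<forall>q\<^sub>1\<in>affine_types U L T n. \<forall>q\<^sub>2\<in>affine_types U L T n. \<forall>t::real.
          0 < t \<and> t < 1 \<and> (\<forall>X\<in>D_space U L T n. p X = (1 - t) * q\<^sub>1 X + t * q\<^sub>2 X) \<longrightarrow> q\<^sub>1 = q\<^sub>2}"

definition realizes ::
    "('c, 'f, 'r) lang \<Rightarrow> ('c, 'f, 'r) cond set \<Rightarrow> nat \<Rightarrow> ('c, 'f, 'r, 'm) struct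
      \<Rightarrow> 'm list \<Rightarrow> (('c, 'f, 'r) fm set \<Rightarrow> real) \<Rightarrow> bool" where
  "realizes L T n M a p \<longleftrightarrow>
     a \<in> tuples M n \<and> (\<forall>\<phi>\<in>affine_fms L n. p (fm_class TYPE('m) L T n \<phi>) = val M \<phi> a)"

definition cl_theory ::
    "('c, 'f, 'r) lang \<Rightarrow> ('c, 'f, 'r, 'm) struct \<Rightarrow> ('c, 'f, 'r) cond set" where
  "cl_theory L M = {(\<phi>, \<psi>) \<in> cl_fms L 0 \<times> cl_fms L 0. val M \<phi> [] \<le> val M \<psi> []}"

definition cl_tp ::
    "('c, 'f, 'r) lang \<Rightarrow> nat \<Rightarrow> ('c, 'f, 'r, 'm) struct \<Rightarrow> 'm list \<Rightarrow> ('c, 'f, 'r) cond set" where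
  "cl_tp L n M a = {(\<phi>, \<psi>) \<in> cl_fms L n \<times> cl_fms L n. val M \<phi> a \<le> val M \<psi> a}"

(* The complete CL n-types of a CL theory: the types of n-tuples in its models with points in 'u. *)
definition cl_types ::
    "'u itself \<Rightarrow> ('c, 'f, 'r) lang \<Rightarrow> ('c, 'f, 'r) cond set \<Rightarrow> nat \<Rightarrow> ('c, 'f, 'r) cond set set" where
  "cl_types (_ :: 'u itself) L TT n =
     {cl_tp L n N b | (N :: ('c, 'f, 'r, 'u) struct) b. models L N TT \<and> b \<in> tuples N n}"

(* For the CL theory of a structure M with points in 'm, this type is large enough for cl_types to
   give all CL types, i.e. those of tuples in models of any size.  Such a type is approximately
   finitely satisfiable in M, hence realized in an ultrapower of M with index set the finite sets of
   formulas, with respect to an ultrafilter containing all sets {s. F <= s}, F finite; this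
   ultrafilter is countably incomplete, so the metric ultrapower is complete.  Its points are
   classes of functions from sets of formulas to 'm. *)
type_synonym ('c, 'f, 'r, 'm) universe = "(('c, 'f, 'r) fm set \<Rightarrow> 'm) set"

end

theory Submission
  imports Defs
begin

text \<open>
  Completeness of \<open>T\<close> makes an inequality between affine formulas a consequence of \<open>T\<close> as soon as
  it holds on \<open>X = M\<^sup>n\<close> (\<open>complete_theory_entails\<close>: take infima over all variables).  A type is
  therefore a state, i.e. a positive normalized linear functional, on the space \<open>V\<close> of the functions
  given on \<open>X\<close> by affine formulas.  The proof locates an extreme state among the points of \<open>X\<close>, first
  approximately and then, by a limit, exactly.

  \<^emph>\<open>Approximation.\<close>  By Hahn-Banach, a state \<open>\<rho>\<close> of \<open>V\<close> extends to a state \<open>P\<close> of all bounded functions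
  on \<open>X\<close>, which is integration against a finitely additive probability measure.  If a set \<open>A\<close> and its
  complement both have positive measure, conditioning \<open>P\<close> on them writes \<open>\<rho>\<close> as a convex combination
  of two states of \<open>V\<close>; when \<open>\<rho>\<close> is extreme both must agree with \<open>\<rho>\<close>, so that conditioning never
  changes the expectation of a function in \<open>V\<close> (\<open>extreme_state_conditioning\<close>).  But conditioning on
  \<open>{x. \<rho> f + \<epsilon> \<le> f x}\<close> would raise the expectation of \<open>f\<close>.  Hence the points where \<open>f\<close> deviates from
  \<open>\<rho> f\<close> by at least \<open>\<epsilon>\<close> form a null set, and finitely many null sets do not cover \<open>X\<close>: some point of
  \<open>X\<close> has approximately the prescribed value at any finitely many functions of \<open>V\<close>
  (\<open>extreme_state_approx\<close>).

  \<^emph>\<open>Limit.\<close>  For an extreme type \<open>p\<close>, choose for each finite set \<open>s\<close> of formulas a tuple \<open>a\<^sub>s\<close> of \<open>M\<close> on which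
  the affine formulas in \<open>s\<close> have nearly the values prescribed by \<open>p\<close>, and take an ultrafilter on the
  sets of formulas that refines the filter of finite sets ordered by inclusion.  By the theorem of
  Los (\<open>los\<close>), the tuple of classes of \<open>s \<mapsto> a\<^sub>s\<close> realizes \<open>p\<close> in the metric ultrapower of \<open>M\<close>.

  \<^emph>\<open>Return to \<open>M\<close>.\<close>  If \<open>M\<close> is compact, every point of the ultrapower is the class of a constant
  function (\<open>compact_near_constant\<close>); these constants are a realization of \<open>p\<close> in \<open>M\<close>.  In general,
  the ultrapower is a model of the CL theory of \<open>M\<close>, so the CL type of the tuple of classes is
  realized in \<open>M\<close> by hypothesis, and the CL type determines the values of the affine formulas.
\<close>

section \<open>Ultrafilters and ultralimits\<close>

definition ultrafilter :: "'i filter \<Rightarrow> bool" where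
  "ultrafilter U \<longleftrightarrow> U \<noteq> bot \<and> (\<forall>P. eventually P U \<or> eventually (\<lambda>x. \<not> P x) U)"

text \<open>
  Zorn's lemma among the proper filters below \<open>F\<close>.  A minimal one is an ultrafilter: adding the set
  \<open>{x. Q x}\<close> to it gives either the same filter or the improper one.
\<close>
lemma ultrafilter_below:
  fixes F :: "'i filter"
  assumes "F \<noteq> bot"
  obtains U where "U \<le> F" "ultrafilter U"
proof -
  define A where "A = {G. G \<le> F \<and> G \<noteq> bot}"
  define P where "P = (\<lambda>a b :: 'i filter. b \<le> a)"
  have "\<exists>m\<in>A. \<forall>a\<in>A. P m a \<longrightarrow> a = m"
  proof (rule predicate_Zorn)
    show "partial_order_on A (relation_of P A)"
      unfolding P_def by (rule partial_order_on_relation_ofI) auto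
  next
    fix C assume C: "C \<in> Chains (relation_of P A)"
    have CA: "C \<subseteq> A"
      using C unfolding Chains_def relation_of_def by auto
    have lin: "a \<le> b \<or> b \<le> a" if "a \<in> C" "b \<in> C" for a b
      using C that unfolding Chains_def relation_of_def P_def by auto
    show "\<exists>u\<in>A. \<forall>a\<in>C. P a u"
    proof (cases "C = {}")
      case True
      then show ?thesis using assms by (auto simp: A_def)
    next
      case False
      have "eventually Q (Inf C) \<longleftrightarrow> (\<exists>b\<in>C. eventually Q b)" for Q
        by (rule eventually_Inf_base) (use False lin in \<open>auto simp: inf_absorb1 inf_absorb2\<close>)
      moreover have "\<not> eventually (\<lambda>_. False) b" if "b \<in> C" for b
        using that CA by (auto simp: A_def trivial_limit_def)
      ultimately have "Inf C \<noteq> bot"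
        by (auto simp: trivial_limit_def)
      moreover have "Inf C \<le> F"
        using False CA by (auto simp: A_def intro: Inf_lower2)
      ultimately show ?thesis
        by (intro bexI[of _ "Inf C"]) (auto simp: A_def P_def Inf_lower)
    qed
  qed
  then obtain U where U: "U \<le> F" "U \<noteq> bot"
    and min: "\<And>G. G \<le> F \<Longrightarrow> G \<noteq> bot \<Longrightarrow> G \<le> U \<Longrightarrow> G = U"
    by (auto simp: A_def P_def)
  have "eventually Q U \<or> eventually (\<lambda>x. \<not> Q x) U" for Q
  proof (cases "inf U (principal {x. Q x}) = bot")
    case True
    then have "eventually (\<lambda>_. False) (inf U (principal {x. Q x}))"
      by simp
    then show ?thesis
      by (simp add: eventually_inf_principal)
  next
    case False
    then have "inf U (principal {x. Q x}) = U"
      using U by (intro min) (auto intro: le_infI1)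
    then have "U \<le> principal {x. Q x}"
      by (simp add: inf.order_iff)
    then show ?thesis
      by (simp add: le_principal)
  qed
  then show ?thesis
    using U that by (auto simp: ultrafilter_def)
qed

lemma ultrafilter_compact_limit:
  fixes f :: "'i \<Rightarrow> 'a :: topological_space"
  assumes U: "ultrafilter U" and "compact K" and f: "eventually (\<lambda>s. f s \<in> K) U"
  obtains l where "l \<in> K" "(f \<longlongrightarrow> l) U"
proof -
  have "filtermap f U \<noteq> bot" "eventually (\<lambda>x. x \<in> K) (filtermap f U)"
    using U f by (auto simp: ultrafilter_def filtermap_bot_iff eventually_filtermap)
  then obtain l where l: "l \<in> K" "inf (nhds l) (filtermap f U) \<noteq> bot"
    using \<open>compact K\<close> unfolding compact_filter by blast
  have "eventually (\<lambda>s. f s \<in> S) U" if "open S" "l \<in> S" for S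
  proof (rule ccontr)
    assume "\<not> ?thesis"
    then have "eventually (\<lambda>s. f s \<notin> S) U"
      using U by (auto simp: ultrafilter_def)
    then have "eventually (\<lambda>x. x \<notin> S) (inf (nhds l) (filtermap f U))"
      by (intro filter_leD[OF inf_le2]) (simp add: eventually_filtermap)
    moreover have "eventually (\<lambda>x. x \<in> S) (inf (nhds l) (filtermap f U))"
      using that by (intro filter_leD[OF inf_le1]) (auto simp: eventually_nhds)
    ultimately have "eventually (\<lambda>x. False) (inf (nhds l) (filtermap f U))"
      by eventually_elim simp
    then show False
      using l(2) by (simp add: trivial_limit_def)
  qed
  then have "(f \<longlongrightarrow> l) U"
    by (auto simp: tendsto_def)
  with l(1) show ?thesis by (rule that)
qed

lemma tendsto_ultralimit:
  fixes f :: "'i \<Rightarrow> real"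
  assumes U: "ultrafilter U" and f: "\<And>s. \<bar>f s\<bar> \<le> C"
  shows "(f \<longlongrightarrow> Lim U f) U"
proof -
  have "f s \<in> {-C..C}" for s
    using f[of s] by auto
  then obtain l where l: "(f \<longlongrightarrow> l) U"
    using ultrafilter_compact_limit[OF U compact_Icc, of f "-C" C] by auto
  then have "Lim U f = l"
    using U by (intro tendsto_Lim) (auto simp: ultrafilter_def)
  with l show ?thesis by simp
qed

section \<open>Extending states to all bounded functions\<close>

text \<open>
  Linear algebra is done in sets of functions \<open>'x \<Rightarrow> real\<close> with pointwise operations.  Only the values
  on \<open>X\<close> matter, and a state automatically identifies functions that agree on \<open>X\<close>.
\<close>
definition bounded_funs :: "'x set \<Rightarrow> ('x \<Rightarrow> real) set" where
  "bounded_funs X = {f. \<exists>C. \<forall>x\<in>X. \<bar>f x\<bar> \<le> C}"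

definition fun_subspace :: "('x \<Rightarrow> real) set \<Rightarrow> bool" where
  "fun_subspace V \<longleftrightarrow> (\<lambda>_. 1) \<in> V \<and>
     (\<forall>f\<in>V. \<forall>g\<in>V. (\<lambda>x. f x + g x) \<in> V) \<and> (\<forall>c. \<forall>f\<in>V. (\<lambda>x. c * f x) \<in> V)"

definition linear_fun :: "('x \<Rightarrow> real) set \<Rightarrow> (('x \<Rightarrow> real) \<Rightarrow> real) \<Rightarrow> bool" where
  "linear_fun V \<rho> \<longleftrightarrow>
     (\<forall>f\<in>V. \<forall>g\<in>V. \<rho> (\<lambda>x. f x + g x) = \<rho> f + \<rho> g) \<and> (\<forall>c. \<forall>f\<in>V. \<rho> (\<lambda>x. c * f x) = c * \<rho> f)"

definition sublinear_fun :: "('x \<Rightarrow> real) set \<Rightarrow> (('x \<Rightarrow> real) \<Rightarrow> real) \<Rightarrow> bool" where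
  "sublinear_fun V \<rho> \<longleftrightarrow>
     (\<forall>f\<in>V. \<forall>g\<in>V. \<rho> (\<lambda>x. f x + g x) \<le> \<rho> f + \<rho> g) \<and>
     (\<forall>c\<ge>0. \<forall>f\<in>V. \<rho> (\<lambda>x. c * f x) = c * \<rho> f)"

definition state :: "'x set \<Rightarrow> ('x \<Rightarrow> real) set \<Rightarrow> (('x \<Rightarrow> real) \<Rightarrow> real) \<Rightarrow> bool" where
  "state X V \<rho> \<longleftrightarrow> linear_fun V \<rho> \<and> (\<forall>f\<in>V. (\<forall>x\<in>X. 0 \<le> f x) \<longrightarrow> 0 \<le> \<rho> f) \<and> \<rho> (\<lambda>_. 1) = 1"

definition extreme_state :: "'x set \<Rightarrow> ('x \<Rightarrow> real) set \<Rightarrow> (('x \<Rightarrow> real) \<Rightarrow> real) \<Rightarrow> bool" where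
  "extreme_state X V \<rho> \<longleftrightarrow> state X V \<rho> \<and>
     (\<forall>\<sigma> \<tau> t. state X V \<sigma> \<longrightarrow> state X V \<tau> \<longrightarrow> 0 < t \<longrightarrow> t < 1 \<longrightarrow>
        (\<forall>f\<in>V. \<rho> f = (1 - t) * \<sigma> f + t * \<tau> f) \<longrightarrow> (\<forall>f\<in>V. \<sigma> f = \<tau> f))"

lemma fun_subspace_bounded_funs: "fun_subspace (bounded_funs X)"
proof -
  have "(\<lambda>x. f x + g x) \<in> bounded_funs X" if "f \<in> bounded_funs X" "g \<in> bounded_funs X" for f g
  proof -
    from that obtain C D where "\<forall>x\<in>X. \<bar>f x\<bar> \<le> C" "\<forall>x\<in>X. \<bar>g x\<bar> \<le> D"
      by (auto simp: bounded_funs_def)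
    then have "\<forall>x\<in>X. \<bar>f x + g x\<bar> \<le> C + D"
      by (smt (verit))
    then show ?thesis by (auto simp: bounded_funs_def)
  qed
  moreover have "(\<lambda>x. c * f x) \<in> bounded_funs X" if "f \<in> bounded_funs X" for c f
  proof -
    from that obtain C where "\<forall>x\<in>X. \<bar>f x\<bar> \<le> C"
      by (auto simp: bounded_funs_def)
    then have "\<forall>x\<in>X. \<bar>c * f x\<bar> \<le> \<bar>c\<bar> * C"
      by (auto simp: abs_mult mult_left_mono)
    then show ?thesis by (auto simp: bounded_funs_def)
  qed
  ultimately show ?thesis
    by (auto simp: fun_subspace_def bounded_funs_def intro!: exI[of _ 1])
qed

lemma bounded_funs_indicator: "indicator S \<in> bounded_funs X"
  by (auto simp: bounded_funs_def indicator_def intro!: exI[of _ 1])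

lemma bounded_funs_indicator_mult:
  assumes "g \<in> bounded_funs X"
  shows "(\<lambda>x. indicator S x * g x) \<in> bounded_funs X"
proof -
  obtain C where "\<forall>x\<in>X. \<bar>g x\<bar> \<le> C"
    using assms by (auto simp: bounded_funs_def)
  then have "\<forall>x\<in>X. \<bar>indicator S x * g x\<bar> \<le> \<bar>C\<bar>"
    by (force simp: indicator_def)
  then show ?thesis
    by (auto simp: bounded_funs_def)
qed

text \<open>
  The core of the Hahn-Banach theorem, for real functionals on a function space.  By Zorn's lemma
  there is a minimal sublinear functional \<open>m \<le> s\<close>; a chain has its pointwise infimum as a lower bound,
  which is finite because \<open>- s (- f) \<le> r f\<close> for every sublinear \<open>r \<le> s\<close>.  Minimality makes \<open>m\<close> odd, and an
  odd sublinear functional is linear.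
\<close>
lemma sublinear_below_linear:
  fixes s :: "('x \<Rightarrow> real) \<Rightarrow> real"
  assumes V: "fun_subspace V" and s: "sublinear_fun V s"
  obtains l where "linear_fun V l" "\<And>f. f \<in> V \<Longrightarrow> l f \<le> s f"
proof -
  have add: "(\<lambda>x. f x + g x) \<in> V" if "f \<in> V" "g \<in> V" for f g
    using V that by (auto simp: fun_subspace_def)
  have scale: "(\<lambda>x. c * f x) \<in> V" if "f \<in> V" for c f
    using V that by (auto simp: fun_subspace_def)
  have sub_add: "r (\<lambda>x. f x + g x) \<le> r f + r g" if "sublinear_fun V r" "f \<in> V" "g \<in> V" for r f g
    using that by (auto simp: sublinear_fun_def)
  have sub_scale: "r (\<lambda>x. c * f x) = c * r f" if "sublinear_fun V r" "f \<in> V" "0 \<le> c" for r f c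
    using that by (auto simp: sublinear_fun_def)
  have neg: "- r (\<lambda>x. -1 * f x) \<le> r f" if "sublinear_fun V r" "f \<in> V" for r f
    using sub_add[OF that scale[OF that(2), of "-1"]] sub_scale[OF that, of 0] by simp
  define A where "A = {r \<in> extensional V. sublinear_fun V r \<and> (\<forall>f\<in>V. r f \<le> s f)}"
  define P where "P = (\<lambda>r t :: ('x \<Rightarrow> real) \<Rightarrow> real. \<forall>f\<in>V. t f \<le> r f)"
  have sA: "restrict s V \<in> A"
    using s add scale by (auto simp: A_def sublinear_fun_def)
  have "\<exists>m\<in>A. \<forall>a\<in>A. P m a \<longrightarrow> a = m"
  proof (rule predicate_Zorn)
    show "partial_order_on A (relation_of P A)"
    proof (rule partial_order_on_relation_ofI)
      fix a b assume "a \<in> A" "b \<in> A" "P a b" "P b a"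
      then show "a = b"
        by (intro extensionalityI[of a V b]) (auto simp: A_def P_def intro: antisym)
    qed (force simp: P_def)+
  next
    fix C assume C: "C \<in> Chains (relation_of P A)"
    have CA: "C \<subseteq> A"
      using C unfolding Chains_def relation_of_def by auto
    have lin: "P a b \<or> P b a" if "a \<in> C" "b \<in> C" for a b
      using C that unfolding Chains_def relation_of_def by auto
    show "\<exists>u\<in>A. \<forall>a\<in>C. P a u"
    proof (cases "C = {}")
      case True
      then show ?thesis using sA by auto
    next
      case False
      define u where "u = restrict (\<lambda>f. INF r\<in>C. r f) V"
      have bdd: "bdd_below ((\<lambda>r. r f) ` C)" if "f \<in> V" for f
      proof (rule bdd_belowI2)
        fix r assume "r \<in> C"
        then have r: "sublinear_fun V r" "r (\<lambda>x. -1 * f x) \<le> s (\<lambda>x. -1 * f x)"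
          using CA scale[OF that, of "-1"] by (auto simp: A_def)
        then show "- s (\<lambda>x. -1 * f x) \<le> r f"
          using neg[OF r(1) that] by linarith
      qed
      have low: "u f \<le> r f" if "f \<in> V" "r \<in> C" for f r
        using that bdd by (auto simp: u_def intro: cINF_lower)
      have great: "c \<le> u f" if "f \<in> V" "\<And>r. r \<in> C \<Longrightarrow> c \<le> r f" for f c
        using that False by (auto simp: u_def intro: cINF_greatest)
      have "u (\<lambda>x. f x + g x) \<le> u f + u g" if f: "f \<in> V" and g: "g \<in> V" for f g
      proof -
        have "u (\<lambda>x. f x + g x) \<le> r f + t g" if rt: "r \<in> C" "t \<in> C" for r t
        proof -
          obtain m where m: "m \<in> C" "m f \<le> r f" "m g \<le> t g"
            using lin[OF rt] rt f g by (auto simp: P_def)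
          then have "u (\<lambda>x. f x + g x) \<le> m f + m g"
            using low[OF add[OF f g] m(1)] sub_add[OF _ f g, of m] CA by (force simp: A_def)
          with m show ?thesis by linarith
        qed
        then have "u (\<lambda>x. f x + g x) - t g \<le> u f" if "t \<in> C" for t
          using that by (intro great[OF f]) (smt (verit))
        then have "u (\<lambda>x. f x + g x) - u f \<le> u g"
          by (intro great[OF g]) (smt (verit))
        then show ?thesis by linarith
      qed
      moreover have "u (\<lambda>x. c * f x) = c * u f" if c: "0 \<le> c" and f: "f \<in> V" for c f
      proof (cases "c = 0")
        case True
        have "r (\<lambda>x. 0) = 0" if "r \<in> C" for r
          using sub_scale[OF _ f, of r 0] that CA by (auto simp: A_def)
        then have "(\<lambda>r. r (\<lambda>x. 0)) ` C = (\<lambda>r. 0) ` C"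
          by (intro image_cong) auto
        then show ?thesis
          using True scale[OF f, of 0] \<open>C \<noteq> {}\<close> by (simp add: u_def image_constant_conv)
      next
        case False
        have eq: "r (\<lambda>x. c * f x) = c * r f" if "r \<in> C" for r
          using that CA c f by (intro sub_scale) (auto simp: A_def)
        show ?thesis
        proof (rule antisym)
          have "u (\<lambda>x. c * f x) / c \<le> u f"
          proof (rule great[OF f])
            fix r assume r: "r \<in> C"
            show "u (\<lambda>x. c * f x) / c \<le> r f"
              using low[OF scale[OF f] r, of c] False c unfolding eq[OF r] by (simp add: field_simps)
          qed
          then show "u (\<lambda>x. c * f x) \<le> c * u f"
            using False c by (simp add: field_simps)
        next
          show "c * u f \<le> u (\<lambda>x. c * f x)"
          proof (rule great[OF scale[OF f]])
            fix r assume "r \<in> C"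
            then show "c * u f \<le> r (\<lambda>x. c * f x)"
              unfolding eq[OF \<open>r \<in> C\<close>] using low[OF f] c by (intro mult_left_mono)
          qed
        qed
      qed
      moreover have "u f \<le> s f" if "f \<in> V" for f
      proof -
        obtain r where r: "r \<in> C" using False by auto
        then have "r f \<le> s f" using CA that by (auto simp: A_def)
        with low[OF that r] show ?thesis by simp
      qed
      ultimately have "u \<in> A"
        by (auto simp: A_def sublinear_fun_def u_def)
      with low show ?thesis
        by (intro bexI[of _ u]) (auto simp: P_def)
    qed
  qed
  then obtain m where mA: "m \<in> A" and min: "\<And>r. r \<in> A \<Longrightarrow> (\<forall>f\<in>V. r f \<le> m f) \<Longrightarrow> r = m"
    by (auto simp: P_def)
  then have m: "sublinear_fun V m" and ms: "\<And>f. f \<in> V \<Longrightarrow> m f \<le> s f"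
    by (auto simp: A_def)
  have neg_eq: "m (\<lambda>x. -1 * g x) = - m g" if g: "g \<in> V" for g
  proof -
    \<comment> \<open>The functional \<open>f \<mapsto> inf\<^bsub>t \<ge> 0\<^esub> (m (f + t g) - t m g)\<close> is sublinear and at most \<open>m\<close> (take \<open>t = 0\<close>),
      hence equal to \<open>m\<close>; at \<open>f = - g\<close> and \<open>t = 1\<close> this gives \<open>m (- g) \<le> - m g\<close>.\<close>
    define S where "S = (\<lambda>f. (\<lambda>t. m (\<lambda>x. f x + t * g x) - t * m g) ` {0..})"
    define r where "r = restrict (\<lambda>f. Inf (S f)) V"
    have fg: "(\<lambda>x. f x + t * g x) \<in> V" if "f \<in> V" for f t
      using add[OF that scale[OF g]] .
    have bdd: "bdd_below (S f)" if "f \<in> V" for f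
      unfolding S_def
    proof (rule bdd_belowI2)
      fix t :: real assume t: "t \<in> {0..}"
      have "m (\<lambda>x. t * g x) \<le> m (\<lambda>x. f x + t * g x) + m (\<lambda>x. -1 * f x)"
        using sub_add[OF m fg[OF that, of t] scale[OF that, of "-1"]] by simp
      then show "- m (\<lambda>x. -1 * f x) \<le> m (\<lambda>x. f x + t * g x) - t * m g"
        using sub_scale[OF m g, of t] t by simp
    qed
    have low: "r f \<le> m (\<lambda>x. f x + t * g x) - t * m g" if "f \<in> V" "0 \<le> t" for f t
      using that bdd[OF that(1)] by (auto simp: r_def S_def intro!: cInf_lower)
    have great: "c \<le> r f" if "f \<in> V" "\<And>t. 0 \<le> t \<Longrightarrow> c \<le> m (\<lambda>x. f x + t * g x) - t * m g" for f c
      using that by (auto simp: r_def S_def intro!: cInf_greatest)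
    have "r (\<lambda>x. f x + h x) \<le> r f + r h" if f: "f \<in> V" and h: "h \<in> V" for f h
    proof -
      have key: "r (\<lambda>x. f x + h x) \<le> (m (\<lambda>x. f x + t * g x) - t * m g) + (m (\<lambda>x. h x + t' * g x) - t' * m g)"
        if "0 \<le> t" "0 \<le> t'" for t t'
        using low[OF add[OF f h], of "t + t'"] sub_add[OF m fg[OF f, of t] fg[OF h, of t']] that
        by (simp add: algebra_simps)
      have "r (\<lambda>x. f x + h x) - (m (\<lambda>x. h x + t' * g x) - t' * m g) \<le> r f" if t': "0 \<le> t'" for t'
      proof (rule great[OF f])
        fix t :: real assume "0 \<le> t"
        from key[OF this t'] show "r (\<lambda>x. f x + h x) - (m (\<lambda>x. h x + t' * g x) - t' * m g)
            \<le> m (\<lambda>x. f x + t * g x) - t * m g" by linarith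
      qed
      then have "r (\<lambda>x. f x + h x) - r f \<le> m (\<lambda>x. h x + t' * g x) - t' * m g" if "0 \<le> t'" for t'
        using that by force
      then have "r (\<lambda>x. f x + h x) - r f \<le> r h"
        by (rule great[OF h])
      then show ?thesis by linarith
    qed
    moreover have "r (\<lambda>x. c * f x) = c * r f" if c: "0 \<le> c" and f: "f \<in> V" for c f
    proof (cases "c = 0")
      case True
      have z: "(\<lambda>x. 0) \<in> V"
        using scale[OF g, of 0] by simp
      have "S (\<lambda>x. 0) = {0}"
        using sub_scale[OF m g] by (auto simp: S_def)
      then show ?thesis
        using True z by (simp add: r_def)
    next
      case False
      have eq: "m (\<lambda>x. c * f x + (c * t) * g x) = c * m (\<lambda>x. f x + t * g x)" for t
        using sub_scale[OF m fg[OF f] c, of t] by (simp add: algebra_simps)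
      show ?thesis
      proof (rule antisym)
        have "r (\<lambda>x. c * f x) / c \<le> r f"
        proof (rule great[OF f])
          fix t :: real assume "0 \<le> t"
          then have "r (\<lambda>x. c * f x) \<le> c * (m (\<lambda>x. f x + t * g x) - t * m g)"
            using low[OF scale[OF f], of "c * t" c] eq[of t] c by (simp add: algebra_simps)
          then show "r (\<lambda>x. c * f x) / c \<le> m (\<lambda>x. f x + t * g x) - t * m g"
            using c False by (simp add: field_simps)
        qed
        then show "r (\<lambda>x. c * f x) \<le> c * r f"
          using False c by (simp add: field_simps)
      next
        show "c * r f \<le> r (\<lambda>x. c * f x)"
        proof (rule great[OF scale[OF f]])
          fix t :: real assume t: "0 \<le> t"
          then have "c * r f \<le> c * (m (\<lambda>x. f x + (t / c) * g x) - (t / c) * m g)"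
            using low[OF f, of "t / c"] c by (intro mult_left_mono) auto
          then show "c * r f \<le> m (\<lambda>x. c * f x + t * g x) - t * m g"
            using eq[of "t / c"] False by (simp add: algebra_simps)
        qed
      qed
    qed
    moreover have rm: "r f \<le> m f" if "f \<in> V" for f
      using low[OF that, of 0] by simp
    moreover have "r f \<le> s f" if "f \<in> V" for f
      using rm[OF that] ms[OF that] by linarith
    moreover have "r \<in> extensional V"
      by (simp add: r_def)
    ultimately have "r \<in> A"
      by (auto simp: A_def sublinear_fun_def)
    then have "r = m"
      using rm by (intro min) auto
    then have "m (\<lambda>x. -1 * g x) \<le> m (\<lambda>x. 0 * g x) - m g"
      using low[OF scale[OF g], of 1 "-1"] by simp
    then show ?thesis
      using neg[OF m g] sub_scale[OF m g, of 0] by simp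
  qed
  have "m (\<lambda>x. f x + g x) = m f + m g" if f: "f \<in> V" and g: "g \<in> V" for f g
  proof (rule antisym)
    have "m f \<le> m (\<lambda>x. f x + g x) + m (\<lambda>x. -1 * g x)"
      using sub_add[OF m add[OF f g] scale[OF g, of "-1"]] by simp
    then show "m f + m g \<le> m (\<lambda>x. f x + g x)"
      using neg_eq[OF g] by simp
  qed (rule sub_add[OF m f g])
  moreover have "m (\<lambda>x. c * f x) = c * m f" if f: "f \<in> V" for c f
  proof (cases "0 \<le> c")
    case False
    then show ?thesis
      using neg_eq[OF scale[OF f, of "-c"]] sub_scale[OF m f, of "-c"] by simp
  qed (rule sub_scale[OF m f])
  ultimately have "linear_fun V m"
    by (simp add: linear_fun_def)
  with ms show ?thesis
    by (rule that[rotated])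
qed

lemma state_mono:
  assumes V: "fun_subspace V" and \<rho>: "state X V \<rho>" and "f \<in> V" "g \<in> V" "\<And>x. x \<in> X \<Longrightarrow> f x \<le> g x"
  shows "\<rho> f \<le> \<rho> g"
proof -
  have "(\<lambda>x. -1 * f x) \<in> V"
    using V \<open>f \<in> V\<close> by (auto simp only: fun_subspace_def)
  then have "(\<lambda>x. g x + -1 * f x) \<in> V" "\<rho> (\<lambda>x. g x + -1 * f x) = \<rho> g + -1 * \<rho> f"
    using V \<rho> assms(3,4) by (auto simp only: fun_subspace_def state_def linear_fun_def)
  moreover have "\<forall>x\<in>X. 0 \<le> g x + -1 * f x"
    using assms(5) by simp
  moreover have "0 \<le> \<rho> h" if "h \<in> V" "\<forall>x\<in>X. 0 \<le> h x" for h
    using \<rho> that by (simp only: state_def)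
  ultimately have "0 \<le> \<rho> g + -1 * \<rho> f"
    by force
  then show ?thesis by simp
qed

text \<open>
  The sublinear functional that sends \<open>f\<close> to the infimum of \<open>\<rho> g\<close> over the \<open>g \<in> V\<close> above \<open>f\<close> is at most
  \<open>\<rho>\<close> on \<open>V\<close>.  A linear functional below it is at most \<open>\<rho>\<close> on \<open>V\<close>, hence equal to \<open>\<rho>\<close> there, and it is
  positive because the infimum is at most \<open>0\<close> at a nonpositive \<open>f\<close>.  Constants in \<open>V\<close> and boundedness
  keep the infimum finite.
\<close>
lemma state_extension:
  assumes V: "fun_subspace V" and bV: "V \<subseteq> bounded_funs X" and \<rho>: "state X V \<rho>"
  obtains P where "state X (bounded_funs X) P" "\<And>f. f \<in> V \<Longrightarrow> P f = \<rho> f"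
proof -
  let ?B = "bounded_funs X"
  have B: "fun_subspace ?B"
    by (rule fun_subspace_bounded_funs)
  have add: "(\<lambda>x. f x + g x) \<in> V" if "f \<in> V" "g \<in> V" for f g
    using V that by (auto simp: fun_subspace_def)
  have scale: "(\<lambda>x. c * f x) \<in> V" if "f \<in> V" for c f
    using V that by (auto simp: fun_subspace_def)
  have \<rho>_add: "\<rho> (\<lambda>x. f x + g x) = \<rho> f + \<rho> g" if "f \<in> V" "g \<in> V" for f g
    using \<rho> that by (auto simp: state_def linear_fun_def)
  have \<rho>_scale: "\<rho> (\<lambda>x. c * f x) = c * \<rho> f" if "f \<in> V" for c f
    using \<rho> that by (auto simp: state_def linear_fun_def)
  have const: "(\<lambda>x. c) \<in> V" "\<rho> (\<lambda>x. c) = c" for c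
  proof -
    have 1: "(\<lambda>x. 1) \<in> V" "\<rho> (\<lambda>x. 1) = 1"
      using V \<rho> by (auto simp: fun_subspace_def state_def)
    show "(\<lambda>x. c) \<in> V" "\<rho> (\<lambda>x. c) = c"
      using scale[OF 1(1), of c] \<rho>_scale[OF 1(1), of c] 1 by auto
  qed
  define S where "S = (\<lambda>f. \<rho> ` {g \<in> V. \<forall>x\<in>X. f x \<le> g x})"
  define s where "s = (\<lambda>f. Inf (S f))"
  have ne: "S f \<noteq> {}" if f: "f \<in> ?B" for f
  proof -
    obtain C where "\<forall>x\<in>X. \<bar>f x\<bar> \<le> C" using f by (auto simp: bounded_funs_def)
    then have "(\<lambda>_. C) \<in> {g \<in> V. \<forall>x\<in>X. f x \<le> g x}"
      using const by (auto simp: abs_le_iff)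
    then show ?thesis by (auto simp: S_def)
  qed
  have bdd: "bdd_below (S f)" if f: "f \<in> ?B" for f
  proof -
    obtain C where C: "\<forall>x\<in>X. \<bar>f x\<bar> \<le> C" using f by (auto simp: bounded_funs_def)
    have "-C \<le> \<rho> g" if "g \<in> V" "\<forall>x\<in>X. f x \<le> g x" for g
    proof -
      have "-C \<le> g x" if "x \<in> X" for x
        using C \<open>\<forall>x\<in>X. f x \<le> g x\<close> that by (smt (verit))
      then have "\<rho> (\<lambda>_. -C) \<le> \<rho> g"
        by (intro state_mono[OF V \<rho>] const \<open>g \<in> V\<close>)
      then show ?thesis by (simp only: const)
    qed
    then show ?thesis
      by (auto simp: S_def intro!: bdd_belowI2)
  qed
  have low: "s f \<le> \<rho> g" if "f \<in> ?B" "g \<in> V" "\<And>x. x \<in> X \<Longrightarrow> f x \<le> g x" for f g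
    unfolding s_def using that bdd by (intro cInf_lower) (auto simp: S_def)
  have great: "c \<le> s f" if "f \<in> ?B" "\<And>g. g \<in> V \<Longrightarrow> (\<And>x. x \<in> X \<Longrightarrow> f x \<le> g x) \<Longrightarrow> c \<le> \<rho> g" for f c
    unfolding s_def using that ne by (intro cInf_greatest) (auto simp: S_def)
  have Badd: "(\<lambda>x. f x + g x) \<in> ?B" if "f \<in> ?B" "g \<in> ?B" for f g
    using B that by (auto simp: fun_subspace_def)
  have Bscale: "(\<lambda>x. c * f x) \<in> ?B" if "f \<in> ?B" for c f
    using B that by (auto simp: fun_subspace_def)
  have "s (\<lambda>x. f x + g x) \<le> s f + s g" if f: "f \<in> ?B" and g: "g \<in> ?B" for f g
  proof -
    have "s (\<lambda>x. f x + g x) \<le> \<rho> f' + \<rho> g'"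
      if "f' \<in> V" "\<And>x. x \<in> X \<Longrightarrow> f x \<le> f' x" "g' \<in> V" "\<And>x. x \<in> X \<Longrightarrow> g x \<le> g' x" for f' g'
      using low[OF Badd[OF f g] add[OF that(1,3)]] that by (simp add: \<rho>_add add_mono)
    then have "s (\<lambda>x. f x + g x) - \<rho> g' \<le> s f" if "g' \<in> V" "\<And>x. x \<in> X \<Longrightarrow> g x \<le> g' x" for g'
      using that by (intro great[OF f]) (smt (verit))
    then have "s (\<lambda>x. f x + g x) - s f \<le> s g"
      by (intro great[OF g]) (smt (verit))
    then show ?thesis by linarith
  qed
  moreover have "s (\<lambda>x. c * f x) = c * s f" if c: "0 \<le> c" and f: "f \<in> ?B" for c f
  proof (cases "c = 0")
    case True
    have z: "(\<lambda>x. 0) \<in> ?B" using Bscale[OF f, of 0] by simp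
    have "s (\<lambda>x. 0) \<le> 0"
      using low[OF z const(1)[of 0]] const(2)[of 0] by simp
    moreover have "0 \<le> s (\<lambda>x. 0)"
      using \<rho> by (intro great[OF z]) (auto simp: state_def)
    ultimately show ?thesis using True by simp
  next
    case False
    then have c: "0 < c" using c by simp
    show ?thesis
    proof (rule antisym)
      have "s (\<lambda>x. c * f x) / c \<le> s f"
      proof (rule great[OF f])
        fix g assume "g \<in> V" "\<And>x. x \<in> X \<Longrightarrow> f x \<le> g x"
        then have "s (\<lambda>x. c * f x) \<le> \<rho> (\<lambda>x. c * g x)"
          using c by (intro low Bscale f scale) auto
        then show "s (\<lambda>x. c * f x) / c \<le> \<rho> g"
          using c \<open>g \<in> V\<close> by (simp add: field_simps \<rho>_scale)
      qed
      then show "s (\<lambda>x. c * f x) \<le> c * s f"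
        using c by (simp add: field_simps)
    next
      show "c * s f \<le> s (\<lambda>x. c * f x)"
      proof (rule great[OF Bscale[OF f]])
        fix g assume g: "g \<in> V" "\<And>x. x \<in> X \<Longrightarrow> c * f x \<le> g x"
        then have "s f \<le> \<rho> (\<lambda>x. (1 / c) * g x)"
          using c by (intro low f scale) (auto simp: field_simps)
        then show "c * s f \<le> \<rho> g"
          using c g by (simp add: \<rho>_scale[of g "1 / c", simplified] field_simps)
      qed
    qed
  qed
  ultimately have "sublinear_fun ?B s"
    by (simp add: sublinear_fun_def)
  with B obtain P where P: "linear_fun ?B P" and Ps: "\<And>f. f \<in> ?B \<Longrightarrow> P f \<le> s f"
    by (rule sublinear_below_linear) blast
  have P_scale: "P (\<lambda>x. c * f x) = c * P f" if "f \<in> ?B" for c f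
    using P that by (auto simp: linear_fun_def)
  have Prho: "P f = \<rho> f" if f: "f \<in> V" for f
  proof (rule antisym)
    have le: "P g \<le> \<rho> g" if "g \<in> V" for g
      using Ps[of g] low[of g g] that bV by auto
    show "P f \<le> \<rho> f" using f by (rule le)
    have "P (\<lambda>x. -1 * f x) \<le> \<rho> (\<lambda>x. -1 * f x)"
      using f by (intro le scale)
    then show "\<rho> f \<le> P f"
      unfolding \<rho>_scale[OF f] P_scale[OF subsetD[OF bV f]] by simp
  qed
  have "0 \<le> P f" if f: "f \<in> ?B" and pos: "\<forall>x\<in>X. 0 \<le> f x" for f
  proof -
    have "P (\<lambda>x. -1 * f x) \<le> s (\<lambda>x. -1 * f x)"
      using f by (intro Ps Bscale)
    also have "\<dots> \<le> \<rho> (\<lambda>x. 0)"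
      using f pos by (intro low Bscale const) auto
    finally show ?thesis
      unfolding P_scale[OF f] const by simp
  qed
  then have "state X ?B P"
    using P Prho[OF const(1), of 1] const(2)[of 1] by (simp add: state_def)
  with Prho show ?thesis by (rule that[rotated])
qed

section \<open>Extreme states are limits of points\<close>

text \<open>
  The number \<open>P (indicator A)\<close> is the measure of \<open>A\<close>.  If it lies strictly between \<open>0\<close> and \<open>1\<close>,
  conditioning on \<open>A\<close> and on its complement decomposes \<open>\<rho>\<close>, and extremality gives the claim; if it is
  \<open>0\<close> or \<open>1\<close>, one of \<open>A\<close> and its complement is null and the claim holds for any state.
\<close>
lemma extreme_state_conditioning:
  assumes V: "fun_subspace V" and bV: "V \<subseteq> bounded_funs X" and \<rho>: "extreme_state X V \<rho>"
    and P: "state X (bounded_funs X) P" and P\<rho>: "\<And>f. f \<in> V \<Longrightarrow> P f = \<rho> f"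
    and f: "f \<in> V"
  shows "P (\<lambda>x. indicator A x * f x) = P (indicator A) * \<rho> f"
proof -
  let ?B = "bounded_funs X"
  have B: "fun_subspace ?B"
    by (rule fun_subspace_bounded_funs)
  have P_add: "P (\<lambda>x. g x + h x) = P g + P h" if "g \<in> ?B" "h \<in> ?B" for g h
    using P that by (auto simp: state_def linear_fun_def)
  have P_scale: "P (\<lambda>x. c * g x) = c * P g" if "g \<in> ?B" for c g
    using P that by (auto simp: state_def linear_fun_def)
  have P_pos: "0 \<le> P g" if "g \<in> ?B" "\<And>x. x \<in> X \<Longrightarrow> 0 \<le> g x" for g
    using P that by (auto simp: state_def)
  note IB = bounded_funs_indicator_mult[of _ X]
  note ind = bounded_funs_indicator[of _ X]
  have sum: "P (indicator S) + P (indicator (- S)) = 1" for S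
  proof -
    have "P (\<lambda>x. indicator S x + indicator (- S) x) = P (\<lambda>x. 1)"
      by (rule arg_cong[of _ _ P]) (auto simp: indicator_def)
    then show ?thesis
      using P P_add[OF ind ind] by (auto simp: state_def)
  qed
  have split: "P (\<lambda>x. indicator S x * g x) + P (\<lambda>x. indicator (- S) x * g x) = P g" if "g \<in> ?B" for S g
  proof -
    have "P (\<lambda>x. indicator S x * g x + indicator (- S) x * g x) = P g"
      by (rule arg_cong[of _ _ P]) (auto simp: indicator_def)
    then show ?thesis
      using P_add[OF IB[OF that] IB[OF that]] by simp
  qed
  have null: "P (\<lambda>x. indicator S x * g x) = 0" if S: "P (indicator S) = 0" and g: "g \<in> ?B" for S g
  proof -
    obtain C where C: "\<forall>x\<in>X. \<bar>g x\<bar> \<le> C" using g by (auto simp: bounded_funs_def)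
    have CI: "(\<lambda>x. c * indicator S x) \<in> ?B" "P (\<lambda>x. c * indicator S x) = 0" for c
      using B P_scale[OF ind, of c S] S ind by (auto simp: fun_subspace_def)
    have "P (\<lambda>x. indicator S x * g x) \<le> P (\<lambda>x. C * indicator S x)"
      using C by (intro state_mono[OF B P] IB g CI) (auto simp: indicator_def abs_le_iff)
    moreover have "P (\<lambda>x. - C * indicator S x) \<le> P (\<lambda>x. indicator S x * g x)"
      using C by (intro state_mono[OF B P] IB g CI) (auto simp: indicator_def abs_le_iff minus_le_iff)
    ultimately show ?thesis
      unfolding CI(2) by simp
  qed
  define t where "t = P (indicator (- A))"
  have t: "P (indicator A) = 1 - t"
    using sum[of A] by (simp add: t_def)
  have fB: "f \<in> ?B" using f bV by auto
  consider "t = 0" | "t = 1" | "0 < t" "t < 1"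
    using P_pos[OF ind, of A] P_pos[OF ind, of "- A"] sum[of A] t by (fastforce simp: t_def)
  then show ?thesis
  proof cases
    case 1
    then show ?thesis
      using split[OF fB, of A] null[OF _ fB, of "- A"] t P\<rho>[OF f] by (simp add: t_def)
  next
    case 2
    then show ?thesis
      using null[OF _ fB, of A] t by simp
  next
    case 3
    define \<kappa> where "\<kappa> = (\<lambda>S g. P (\<lambda>x. indicator S x * g x) / P (indicator S))"
    have "state X V (\<kappa> S)" if S: "0 < P (indicator S)" for S
    proof -
      have "\<kappa> S (\<lambda>x. g x + h x) = \<kappa> S g + \<kappa> S h" if "g \<in> V" "h \<in> V" for g h
        using P_add[OF IB IB, of g h S S] subsetD[OF bV] that
        by (auto simp: \<kappa>_def algebra_simps add_divide_distrib)
      moreover have "\<kappa> S (\<lambda>x. c * g x) = c * \<kappa> S g" if "g \<in> V" for c g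
        using P_scale[OF IB, of g c S] subsetD[OF bV] that by (auto simp: \<kappa>_def mult.left_commute)
      moreover have "0 \<le> \<kappa> S g" if "g \<in> V" "\<forall>x\<in>X. 0 \<le> g x" for g
        using P_pos[OF IB, of g S] subsetD[OF bV] that S by (auto simp: \<kappa>_def)
      ultimately show ?thesis
        using S by (simp add: state_def linear_fun_def \<kappa>_def eta_contract_eq)
    qed
    then have "state X V (\<kappa> A)" "state X V (\<kappa> (- A))"
      using 3 t by (auto simp: t_def)
    moreover have "\<rho> g = (1 - t) * \<kappa> A g + t * \<kappa> (- A) g" if "g \<in> V" for g
    proof -
      have "(1 - t) * \<kappa> A g = P (\<lambda>x. indicator A x * g x)" "t * \<kappa> (- A) g = P (\<lambda>x. indicator (- A) x * g x)"
        using 3 t by (auto simp: \<kappa>_def t_def)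
      then show ?thesis
        using split[of g A] P\<rho>[OF that] that bV by auto
    qed
    ultimately have eq: "\<kappa> A f = \<kappa> (- A) f" and dec: "\<rho> f = (1 - t) * \<kappa> A f + t * \<kappa> (- A) f"
      using \<rho> 3 f unfolding extreme_state_def by blast+
    have "\<rho> f = \<kappa> A f"
      unfolding dec eq by (simp add: algebra_simps)
    then show ?thesis
      using 3 t by (simp add: \<kappa>_def)
  qed
qed

text \<open>
  The set of points at which some \<open>f \<in> F\<close> deviates from \<open>\<rho> f\<close> by at least \<open>\<epsilon>\<close> is a finite union of null
  sets, whereas \<open>X\<close> has measure \<open>1\<close>.
\<close>
lemma extreme_state_approx:
  assumes V: "fun_subspace V" and bV: "V \<subseteq> bounded_funs X" and \<rho>: "extreme_state X V \<rho>"
    and F: "finite F" "F \<subseteq> V" and \<epsilon>: "0 < \<epsilon>"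
  shows "\<exists>x\<in>X. \<forall>f\<in>F. \<bar>f x - \<rho> f\<bar> < \<epsilon>"
proof -
  let ?B = "bounded_funs X"
  have st: "state X V \<rho>"
    using \<rho> by (simp add: extreme_state_def)
  obtain P where P: "state X ?B P" and P\<rho>: "\<And>f. f \<in> V \<Longrightarrow> P f = \<rho> f"
    using state_extension[OF V bV st] by blast
  have B: "fun_subspace ?B"
    by (rule fun_subspace_bounded_funs)
  have P_scale: "P (\<lambda>x. c * g x) = c * P g" if "g \<in> ?B" for c g
    using P that by (auto simp: state_def linear_fun_def)
  note ind = bounded_funs_indicator[of _ X]
  have Bscale: "(\<lambda>x. c * indicator S x) \<in> ?B" for c and S :: "'a set"
    using B ind[of S] by (auto simp: fun_subspace_def)
  have indadd: "(\<lambda>x. indicator S x + indicator S' x) \<in> ?B" for S S' :: "'a set"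
    using B ind[of S] ind[of S'] by (auto simp: fun_subspace_def)
  have IB: "(\<lambda>x. indicator S x * f x) \<in> ?B" if "f \<in> V" for S :: "'a set" and f
    using that bV by (intro bounded_funs_indicator_mult) auto
  have pos: "0 \<le> P (indicator S)" for S
    using P ind[of S] by (auto simp: state_def)
  \<comment> \<open>Deviations below \<open>\<rho> f\<close> are deviations of \<open>- f\<close> above \<open>\<rho> (- f)\<close>, so this case suffices.\<close>
  have upper: "P (indicator {x. \<rho> f + \<epsilon> \<le> f x}) = 0" if f: "f \<in> V" for f
  proof -
    let ?S = "{x. \<rho> f + \<epsilon> \<le> f x}"
    have "P (\<lambda>x. (\<rho> f + \<epsilon>) * indicator ?S x) \<le> P (\<lambda>x. indicator ?S x * f x)"
      by (intro state_mono[OF B P] IB f Bscale) (auto simp: indicator_def)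
    then have "(\<rho> f + \<epsilon>) * P (indicator ?S) \<le> P (indicator ?S) * \<rho> f"
      using extreme_state_conditioning[OF V bV \<rho> P P\<rho> f, of ?S] P_scale[OF ind, of "\<rho> f + \<epsilon>" ?S]
      by simp
    then have "\<epsilon> * P (indicator ?S) \<le> 0"
      by (simp add: algebra_simps)
    then show ?thesis
      using \<epsilon> pos[of ?S] by (simp add: mult_le_0_iff)
  qed
  have dev: "P (indicator {x. \<epsilon> \<le> \<bar>f x - \<rho> f\<bar>}) \<le> 0" if f: "f \<in> V" for f
  proof -
    let ?S = "{x. \<rho> f + \<epsilon> \<le> f x}" and ?S' = "{x. \<rho> (\<lambda>x. -1 * f x) + \<epsilon> \<le> -1 * f x}"
    have f': "(\<lambda>x. -1 * f x) \<in> V" "\<rho> (\<lambda>x. -1 * f x) = -1 * \<rho> f"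
      using V f st by (auto simp only: fun_subspace_def state_def linear_fun_def)
    have "P (indicator {x. \<epsilon> \<le> \<bar>f x - \<rho> f\<bar>}) \<le> P (\<lambda>x. indicator ?S x + indicator ?S' x)"
      unfolding f'(2) by (intro state_mono[OF B P] ind indadd) (auto simp: indicator_def)
    also have "\<dots> = P (indicator ?S) + P (indicator ?S')"
      using P ind by (simp add: state_def linear_fun_def)
    finally show ?thesis
      using upper[OF f] upper[OF f'(1)] by simp
  qed
  have "P (indicator {x. \<exists>f\<in>F. \<epsilon> \<le> \<bar>f x - \<rho> f\<bar>}) \<le> 0"
    using F
  proof (induction F)
    case empty
    then show ?case
      using P_scale[OF ind, of 0 "{}"] by (simp add: indicator_def)
  next
    case (insert f F)
    have "P (indicator {x. \<exists>g\<in>insert f F. \<epsilon> \<le> \<bar>g x - \<rho> g\<bar>})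
        \<le> P (\<lambda>x. indicator {x. \<epsilon> \<le> \<bar>f x - \<rho> f\<bar>} x + indicator {x. \<exists>g\<in>F. \<epsilon> \<le> \<bar>g x - \<rho> g\<bar>} x)"
      by (intro state_mono[OF B P] ind indadd) (auto simp: indicator_def)
    also have "\<dots> = P (indicator {x. \<epsilon> \<le> \<bar>f x - \<rho> f\<bar>}) + P (indicator {x. \<exists>g\<in>F. \<epsilon> \<le> \<bar>g x - \<rho> g\<bar>})"
      using P ind by (simp add: state_def linear_fun_def)
    finally show ?case
      using insert dev[of f] by force
  qed
  moreover have "P (\<lambda>_. 1) = 1"
    using P by (simp add: state_def)
  moreover have "P (\<lambda>_. 1) \<le> P (indicator {x. \<exists>f\<in>F. \<epsilon> \<le> \<bar>f x - \<rho> f\<bar>})"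
    if "\<not> ?thesis"
    using B that by (intro state_mono[OF B P] ind) (auto simp: fun_subspace_def indicator_def not_less)
  ultimately show ?thesis by linarith
qed

section \<open>Values of formulas\<close>

lemma tm_val_cong:
  "(\<And>v. v \<in> tm_vars t \<Longrightarrow> e v = e' v) \<Longrightarrow> tm_val M e t = tm_val M e' t"
proof (induction t)
  case (TFun F ts)
  then have "map (tm_val M e) ts = map (tm_val M e') ts"
    by (intro map_cong) auto
  then show ?case by (simp only: tm_val.simps)
qed auto

lemma fm_val_cong:
  "(\<And>v. v \<in> free_vars \<phi> \<Longrightarrow> e v = e' v) \<Longrightarrow> fm_val M \<phi> e = fm_val M \<phi> e'"
proof (induction \<phi> arbitrary: e e')
  case (FDist s t)
  then show ?case using tm_val_cong[of s e e' M] tm_val_cong[of t e e' M] by simp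
next
  case (FRel R ts)
  then have "map (tm_val M e) ts = map (tm_val M e') ts"
    by (intro map_cong refl tm_val_cong) auto
  then show ?case by (simp only: fm_val.simps)
next
  case (FAdd \<phi> \<psi>)
  show ?case using FAdd.IH(1)[of e e'] FAdd.IH(2)[of e e'] FAdd.prems by simp
next
  case (FSup v \<phi>)
  have "fm_val M \<phi> (e(v := x)) = fm_val M \<phi> (e'(v := x))" for x
    using FSup.prems by (intro FSup.IH) auto
  then show ?case by simp
next
  case (FInf v \<phi>)
  have "fm_val M \<phi> (e(v := x)) = fm_val M \<phi> (e'(v := x))" for x
    using FInf.prems by (intro FInf.IH) auto
  then show ?case by simp
next
  case (FMin \<phi> \<psi>)
  show ?case using FMin.IH(1)[of e e'] FMin.IH(2)[of e e'] FMin.prems by simp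
next
  case (FMax \<phi> \<psi>)
  show ?case using FMax.IH(1)[of e e'] FMax.IH(2)[of e e'] FMax.prems by simp
next
  case (FScale r \<phi>)
  show ?case using FScale.IH[of e e'] FScale.prems by simp
qed simp

lemma val_eq_fm_val:
  assumes "\<phi> \<in> cl_fms L n" "\<And>i. i < n \<Longrightarrow> e i = a ! i"
  shows "val M \<phi> a = fm_val M \<phi> e"
  unfolding val_def using assms by (intro fm_val_cong) (auto simp: cl_fms_def)

lemma tm_val_in_mspace:
  assumes M: "is_struct L M" and e: "\<And>v. e v \<in> mspace (met M)"
  shows "tm_in L t \<Longrightarrow> tm_val M e t \<in> mspace (met M)"
proof (induction t)
  case (TFun F ts)
  then have "map (tm_val M e) ts \<in> tuples M (fun_ar L F)"
    by (auto simp: tuples_def)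
  then show ?case
    using M TFun.prems by (simp add: is_struct_def)
next
  case (TCst c)
  then show ?case using M by (simp add: is_struct_def)
qed (simp add: e)

text \<open>
  The uniform bound makes suprema and infima over the structure genuine ones and guarantees that
  ultralimits of values exist.
\<close>
lemma fm_val_bounded:
  assumes M: "is_struct L M"
  shows "fm_in L \<phi> \<Longrightarrow> \<exists>C. \<forall>e. (\<forall>v. e v \<in> mspace (met M)) \<longrightarrow> \<bar>fm_val M \<phi> e\<bar> \<le> C"
proof (induction \<phi>)
  case (FReal r)
  then show ?case by auto
next
  case (FDist s t)
  have "\<bar>fm_val M (FDist s t) e\<bar> \<le> 1" if "\<forall>v. e v \<in> mspace (met M)" for e
    using M FDist tm_val_in_mspace[OF M, of e s] tm_val_in_mspace[OF M, of e t] that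
    by (simp add: is_struct_def)
  then show ?case by blast
next
  case (FRel R ts)
  have "\<bar>fm_val M (FRel R ts) e\<bar> \<le> 1" if "\<forall>v. e v \<in> mspace (met M)" for e
  proof -
    have "map (tm_val M e) ts \<in> tuples M (rel_ar L R)"
      using FRel that by (auto simp: tuples_def intro!: tm_val_in_mspace[OF M])
    then show ?thesis
      using M FRel by (simp add: is_struct_def)
  qed
  then show ?case by blast
next
  case (FScale r \<phi>)
  then obtain C where "\<forall>e. (\<forall>v. e v \<in> mspace (met M)) \<longrightarrow> \<bar>fm_val M \<phi> e\<bar> \<le> C"
    by auto
  then show ?case
    by (intro exI[of _ "\<bar>r\<bar> * C"]) (auto simp: abs_mult mult_left_mono)
next
  case (FAdd \<phi> \<psi>)
  then obtain C D where "\<forall>e. (\<forall>v. e v \<in> mspace (met M)) \<longrightarrow> \<bar>fm_val M \<phi> e\<bar> \<le> C"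
    "\<forall>e. (\<forall>v. e v \<in> mspace (met M)) \<longrightarrow> \<bar>fm_val M \<psi> e\<bar> \<le> D"
    by auto
  then show ?case
    by (intro exI[of _ "C + D"] allI impI) (simp only: fm_val.simps, smt (verit))
next
  case (FSup v \<phi>)
  then obtain C where "\<forall>e. (\<forall>v. e v \<in> mspace (met M)) \<longrightarrow> \<bar>fm_val M \<phi> e\<bar> \<le> C"
    by auto
  then show ?case
    using M by (intro exI[of _ C]) (auto simp: is_struct_def intro!: cSup_abs_le)
next
  case (FInf v \<phi>)
  then obtain C where "\<forall>e. (\<forall>v. e v \<in> mspace (met M)) \<longrightarrow> \<bar>fm_val M \<phi> e\<bar> \<le> C"
    by auto
  then show ?case
    using M by (intro exI[of _ C]) (auto simp: is_struct_def intro!: cInf_abs_ge)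
next
  case (FMin \<phi> \<psi>)
  then obtain C D where "\<forall>e. (\<forall>v. e v \<in> mspace (met M)) \<longrightarrow> \<bar>fm_val M \<phi> e\<bar> \<le> C"
    "\<forall>e. (\<forall>v. e v \<in> mspace (met M)) \<longrightarrow> \<bar>fm_val M \<psi> e\<bar> \<le> D"
    by auto
  then show ?case
    by (intro exI[of _ "max C D"] allI impI) (simp only: fm_val.simps, smt (verit))
next
  case (FMax \<phi> \<psi>)
  then obtain C D where "\<forall>e. (\<forall>v. e v \<in> mspace (met M)) \<longrightarrow> \<bar>fm_val M \<phi> e\<bar> \<le> C"
    "\<forall>e. (\<forall>v. e v \<in> mspace (met M)) \<longrightarrow> \<bar>fm_val M \<psi> e\<bar> \<le> D"
    by auto
  then show ?case
    by (intro exI[of _ "max C D"] allI impI) (simp only: fm_val.simps, smt (verit))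
qed

section \<open>Metric ultrapowers\<close>

text \<open>
  A point of the ultrapower is the class of a function \<open>f\<close> from the index set to \<open>M\<close>, where functions
  are identified when their distance tends to \<open>0\<close> along \<open>U\<close>.  The symbols are interpreted on chosen
  representatives; the Lipschitz conditions make the choice immaterial.
\<close>
locale ultrapower =
  fixes L :: "('c, 'f, 'r) lang" and M :: "('c, 'f, 'r, 'm) struct" and U :: "'i filter"
  assumes M: "is_struct L M" and U: "ultrafilter U"
begin

abbreviation "d \<equiv> mdist (met M)"

definition pts :: "('i \<Rightarrow> 'm) set" where
  "pts = {f. \<forall>s. f s \<in> mspace (met M)}"

definition udist :: "('i \<Rightarrow> 'm) \<Rightarrow> ('i \<Rightarrow> 'm) \<Rightarrow> real" where
  "udist f g = Lim U (\<lambda>s. d (f s) (g s))"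

definition cls :: "('i \<Rightarrow> 'm) \<Rightarrow> ('i \<Rightarrow> 'm) set" where
  "cls f = {g \<in> pts. udist f g = 0}"

definition rep :: "('i \<Rightarrow> 'm) set \<Rightarrow> 'i \<Rightarrow> 'm" where
  "rep A = (SOME f. f \<in> A)"

text \<open>
  The metric axioms of nonnegativity and symmetry are also required off the carrier, hence the
  value \<open>0\<close> there.
\<close>
definition cdist :: "('i \<Rightarrow> 'm) set \<Rightarrow> ('i \<Rightarrow> 'm) set \<Rightarrow> real" where
  "cdist A B = (if A \<in> cls ` pts \<and> B \<in> cls ` pts then udist (rep A) (rep B) else 0)"

definition upower :: "('c, 'f, 'r, ('i \<Rightarrow> 'm) set) struct" where
  "upower =
    \<lparr> met = metric (cls ` pts, cdist),
      cst_int = (\<lambda>c. cls (\<lambda>s. cst_int M c)),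
      fun_int = (\<lambda>F As. cls (\<lambda>s. fun_int M F (map (\<lambda>A. rep A s) As))),
      rel_int = (\<lambda>R As. Lim U (\<lambda>s. rel_int M R (map (\<lambda>A. rep A s) As))) \<rparr>"

lemma nontriv: "U \<noteq> bot"
  using U by (simp add: ultrafilter_def)

lemma udist_tendsto: "f \<in> pts \<Longrightarrow> g \<in> pts \<Longrightarrow> ((\<lambda>s. d (f s) (g s)) \<longlongrightarrow> udist f g) U"
  unfolding udist_def using M
  by (intro tendsto_ultralimit[OF U, of _ 1]) (simp add: is_struct_def pts_def)

lemma udist_nonneg: "f \<in> pts \<Longrightarrow> g \<in> pts \<Longrightarrow> 0 \<le> udist f g"
  by (rule tendsto_lowerbound[OF udist_tendsto _ nontriv]) auto

lemma udist_commute: "udist f g = udist g f"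
  by (simp add: udist_def mdist_commute)

lemma udist_self:
  assumes "f \<in> pts"
  shows "udist f f = 0"
proof -
  have "d (f s) (f s) = 0" for s
    using assms by (simp add: pts_def)
  then show ?thesis
    unfolding udist_def by (intro tendsto_Lim[OF nontriv]) simp
qed

lemma udist_triangle:
  assumes "f \<in> pts" "g \<in> pts" "h \<in> pts"
  shows "udist f h \<le> udist f g + udist g h"
proof (rule tendsto_le[OF nontriv])
  show "((\<lambda>s. d (f s) (g s) + d (g s) (h s)) \<longlongrightarrow> udist f g + udist g h) U"
    using assms by (intro tendsto_add udist_tendsto)
  show "((\<lambda>s. d (f s) (h s)) \<longlongrightarrow> udist f h) U"
    using assms by (intro udist_tendsto)
  show "\<forall>\<^sub>F s in U. d (f s) (h s) \<le> d (f s) (g s) + d (g s) (h s)"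
    using assms by (auto simp: pts_def intro!: always_eventually mdist_triangle)
qed

lemma cls_eq_iff:
  assumes f: "f \<in> pts" and g: "g \<in> pts"
  shows "cls f = cls g \<longleftrightarrow> udist f g = 0"
proof
  assume "cls f = cls g"
  then have "g \<in> cls f"
    using g by (simp add: cls_def udist_self)
  then show "udist f g = 0"
    by (simp add: cls_def)
next
  assume fg: "udist f g = 0"
  have "udist f h = 0 \<longleftrightarrow> udist g h = 0" if h: "h \<in> pts" for h
    using udist_triangle[OF f g h] udist_triangle[OF g f h] udist_nonneg[OF f h]
      udist_nonneg[OF g h] fg by (auto simp: udist_commute)
  then show "cls f = cls g"
    by (auto simp: cls_def)
qed

lemma rep_cls:
  assumes f: "f \<in> pts"
  shows "rep (cls f) \<in> pts" "udist (rep (cls f)) f = 0"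
proof -
  have "f \<in> cls f"
    using f by (simp add: cls_def udist_self)
  then have "rep (cls f) \<in> cls f"
    unfolding rep_def by (rule someI[where P = "\<lambda>g. g \<in> cls f"])
  then show "rep (cls f) \<in> pts" "udist (rep (cls f)) f = 0"
    by (auto simp: cls_def udist_commute)
qed

lemma cdist_cls:
  assumes f: "f \<in> pts" and g: "g \<in> pts"
  shows "cdist (cls f) (cls g) = udist f g"
proof -
  have "udist (rep (cls f)) (rep (cls g)) \<le> udist f g"
    using udist_triangle[of "rep (cls f)" f "rep (cls g)"] udist_triangle[of f g "rep (cls g)"]
      rep_cls[OF f] rep_cls[OF g] f g by (simp add: udist_commute)
  moreover have "udist f g \<le> udist (rep (cls f)) (rep (cls g))"
    using udist_triangle[of f "rep (cls f)" g] udist_triangle[of "rep (cls f)" "rep (cls g)" g]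
      rep_cls[OF f] rep_cls[OF g] f g by (simp add: udist_commute)
  ultimately show ?thesis
    using f g by (simp add: cdist_def)
qed

lemma Metric_space_upower: "Metric_space (cls ` pts) cdist"
proof
  show "0 \<le> cdist A B" for A B
    by (auto simp: cdist_def intro!: udist_nonneg rep_cls)
  show "cdist A B = cdist B A" for A B
    by (auto simp: cdist_def udist_commute)
  show "cdist A B = 0 \<longleftrightarrow> A = B" if "A \<in> cls ` pts" "B \<in> cls ` pts" for A B
    using that by (elim imageE) (simp add: cdist_cls cls_eq_iff)
  show "cdist A C \<le> cdist A B + cdist B C"
    if "A \<in> cls ` pts" "B \<in> cls ` pts" "C \<in> cls ` pts" for A B C
    using that by (auto simp: cdist_cls intro: udist_triangle)
qed

lemma mspace_upower: "mspace (met upower) = cls ` pts"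
  by (simp add: upower_def Metric_space.mspace_metric[OF Metric_space_upower])

lemma mdist_upower: "f \<in> pts \<Longrightarrow> g \<in> pts \<Longrightarrow> mdist (met upower) (cls f) (cls g) = udist f g"
  by (simp add: upower_def Metric_space.mdist_metric[OF Metric_space_upower] cdist_cls)

lemma tuples_upowerE:
  assumes "A \<in> tuples upower k"
  obtains fs where "A = map cls fs" "set fs \<subseteq> pts" "length fs = k"
proof (rule that)
  have A: "set A \<subseteq> cls ` pts" "length A = k"
    using assms by (simp_all add: tuples_def mspace_upower)
  have "cls (rep X) = X \<and> rep X \<in> pts" if "X \<in> cls ` pts" for X
    using that by (elim imageE) (simp add: rep_cls cls_eq_iff)
  then have X: "cls (rep X) = X" "rep X \<in> pts" if "X \<in> set A" for X
    using that A(1) by auto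
  show "A = map cls (map rep A)"
    using X(1) by (simp add: map_idI)
  show "set (map rep A) \<subseteq> pts" "length (map rep A) = k"
    using X(2) A(2) by auto
qed

lemma tuple_at: "set fs \<subseteq> pts \<Longrightarrow> length fs = k \<Longrightarrow> map (\<lambda>f. f s) fs \<in> tuples M k"
  by (auto simp: tuples_def pts_def)

lemma tuple_dist_tendsto:
  assumes "set fs \<subseteq> pts" "length fs = k" "set gs \<subseteq> pts" "length gs = k"
  shows "((\<lambda>s. tuple_dist M k (map (\<lambda>f. f s) fs) (map (\<lambda>f. f s) gs))
            \<longlongrightarrow> (\<Sum>i<k. (1/2) ^ i * udist (fs ! i) (gs ! i))) U"
proof -
  have "((\<lambda>s. \<Sum>i<k. (1/2) ^ i * d ((fs ! i) s) ((gs ! i) s))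
            \<longlongrightarrow> (\<Sum>i<k. (1/2) ^ i * udist (fs ! i) (gs ! i))) U"
    using assms by (intro tendsto_sum tendsto_mult tendsto_const udist_tendsto) auto
  then show ?thesis
    using assms by (simp add: tuple_dist_def)
qed

lemma fun_at_pts:
  assumes "F \<in> funs_of L" "set fs \<subseteq> pts" "length fs = fun_ar L F"
  shows "(\<lambda>s. fun_int M F (map (\<lambda>f. f s) fs)) \<in> pts"
  using M tuple_at[OF assms(2,3)] assms(1) by (simp add: pts_def is_struct_def)

text \<open>
  This gives both that the interpretation does not depend on the representatives (all distances
  on the right are then \<open>0\<close>) and that it is again Lipschitz.
\<close>
lemma fun_at_lipschitz:
  assumes F: "F \<in> funs_of L" and fs: "set fs \<subseteq> pts" "length fs = fun_ar L F"
    and gs: "set gs \<subseteq> pts" "length gs = fun_ar L F"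
  shows "udist (\<lambda>s. fun_int M F (map (\<lambda>f. f s) fs)) (\<lambda>s. fun_int M F (map (\<lambda>f. f s) gs))
           \<le> fun_lip L F * (\<Sum>i<fun_ar L F. (1/2) ^ i * udist (fs ! i) (gs ! i))"
proof (rule tendsto_le[OF nontriv])
  show "((\<lambda>s. fun_lip L F * tuple_dist M (fun_ar L F) (map (\<lambda>f. f s) fs) (map (\<lambda>f. f s) gs))
      \<longlongrightarrow> fun_lip L F * (\<Sum>i<fun_ar L F. (1/2) ^ i * udist (fs ! i) (gs ! i))) U"
    by (intro tendsto_mult tendsto_const tuple_dist_tendsto fs gs)
  show "((\<lambda>s. d (fun_int M F (map (\<lambda>f. f s) fs)) (fun_int M F (map (\<lambda>f. f s) gs))) \<longlongrightarrow>
      udist (\<lambda>s. fun_int M F (map (\<lambda>f. f s) fs)) (\<lambda>s. fun_int M F (map (\<lambda>f. f s) gs))) U"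
    by (intro udist_tendsto fun_at_pts F fs gs)
  show "\<forall>\<^sub>F s in U. d (fun_int M F (map (\<lambda>f. f s) fs)) (fun_int M F (map (\<lambda>f. f s) gs))
      \<le> fun_lip L F * tuple_dist M (fun_ar L F) (map (\<lambda>f. f s) fs) (map (\<lambda>f. f s) gs)"
    using M F tuple_at[OF fs] tuple_at[OF gs] by (simp add: is_struct_def)
qed

lemma rel_at_tendsto:
  assumes R: "R \<in> rels_of L" and fs: "set fs \<subseteq> pts" "length fs = rel_ar L R"
  shows "((\<lambda>s. rel_int M R (map (\<lambda>f. f s) fs)) \<longlongrightarrow> Lim U (\<lambda>s. rel_int M R (map (\<lambda>f. f s) fs))) U"
  using M R tuple_at[OF fs] by (intro tendsto_ultralimit[OF U, of _ 1]) (simp add: is_struct_def)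

lemma rel_at_lipschitz:
  assumes R: "R \<in> rels_of L" and fs: "set fs \<subseteq> pts" "length fs = rel_ar L R"
    and gs: "set gs \<subseteq> pts" "length gs = rel_ar L R"
  shows "\<bar>Lim U (\<lambda>s. rel_int M R (map (\<lambda>f. f s) fs)) - Lim U (\<lambda>s. rel_int M R (map (\<lambda>f. f s) gs))\<bar>
           \<le> rel_lip L R * (\<Sum>i<rel_ar L R. (1/2) ^ i * udist (fs ! i) (gs ! i))"
proof (rule tendsto_le[OF nontriv])
  show "((\<lambda>s. rel_lip L R * tuple_dist M (rel_ar L R) (map (\<lambda>f. f s) fs) (map (\<lambda>f. f s) gs))
      \<longlongrightarrow> rel_lip L R * (\<Sum>i<rel_ar L R. (1/2) ^ i * udist (fs ! i) (gs ! i))) U"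
    by (intro tendsto_mult tendsto_const tuple_dist_tendsto fs gs)
  show "((\<lambda>s. \<bar>rel_int M R (map (\<lambda>f. f s) fs) - rel_int M R (map (\<lambda>f. f s) gs)\<bar>) \<longlongrightarrow>
      \<bar>Lim U (\<lambda>s. rel_int M R (map (\<lambda>f. f s) fs)) - Lim U (\<lambda>s. rel_int M R (map (\<lambda>f. f s) gs))\<bar>) U"
    by (intro tendsto_rabs tendsto_diff rel_at_tendsto R fs gs)
  show "\<forall>\<^sub>F s in U. \<bar>rel_int M R (map (\<lambda>f. f s) fs) - rel_int M R (map (\<lambda>f. f s) gs)\<bar>
      \<le> rel_lip L R * tuple_dist M (rel_ar L R) (map (\<lambda>f. f s) fs) (map (\<lambda>f. f s) gs)"
    using M R tuple_at[OF fs] tuple_at[OF gs] by (simp add: is_struct_def)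
qed

lemma reps_cls:
  assumes "set fs \<subseteq> pts"
  shows "set (map (\<lambda>f. rep (cls f)) fs) \<subseteq> pts"
    "(\<Sum>i<length fs. (1/2) ^ i * udist (map (\<lambda>f. rep (cls f)) fs ! i) (fs ! i)) = 0"
  using assms by (auto intro!: sum.neutral simp: rep_cls subset_iff)

lemma fun_int_upower:
  assumes F: "F \<in> funs_of L" and fs: "set fs \<subseteq> pts" "length fs = fun_ar L F"
  shows "fun_int upower F (map cls fs) = cls (\<lambda>s. fun_int M F (map (\<lambda>f. f s) fs))"
proof -
  let ?rs = "map (\<lambda>f. rep (cls f)) fs"
  have rs: "set ?rs \<subseteq> pts" "length ?rs = fun_ar L F"
    using reps_cls(1)[OF fs(1)] fs(2) by auto
  have "udist (\<lambda>s. fun_int M F (map (\<lambda>f. f s) ?rs)) (\<lambda>s. fun_int M F (map (\<lambda>f. f s) fs)) \<le> 0"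
    using fun_at_lipschitz[OF F rs fs] reps_cls(2)[OF fs(1)] fs(2) by simp
  then have "cls (\<lambda>s. fun_int M F (map (\<lambda>f. f s) ?rs)) = cls (\<lambda>s. fun_int M F (map (\<lambda>f. f s) fs))"
    using udist_nonneg[OF fun_at_pts[OF F rs] fun_at_pts[OF F fs]]
    by (subst cls_eq_iff[OF fun_at_pts[OF F rs] fun_at_pts[OF F fs]]) simp
  then show ?thesis
    by (simp add: upower_def comp_def)
qed

lemma rel_int_upower:
  assumes R: "R \<in> rels_of L" and fs: "set fs \<subseteq> pts" "length fs = rel_ar L R"
  shows "rel_int upower R (map cls fs) = Lim U (\<lambda>s. rel_int M R (map (\<lambda>f. f s) fs))"
proof -
  let ?rs = "map (\<lambda>f. rep (cls f)) fs"
  have rs: "set ?rs \<subseteq> pts" "length ?rs = rel_ar L R"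
    using reps_cls(1)[OF fs(1)] fs(2) by auto
  have "\<bar>Lim U (\<lambda>s. rel_int M R (map (\<lambda>f. f s) ?rs)) - Lim U (\<lambda>s. rel_int M R (map (\<lambda>f. f s) fs))\<bar> \<le> 0"
    using rel_at_lipschitz[OF R rs fs] reps_cls(2)[OF fs(1)] fs(2) by simp
  then show ?thesis
    by (simp add: upower_def comp_def)
qed

lemma tuple_dist_upower:
  assumes "set fs \<subseteq> pts" "length fs = k" "set gs \<subseteq> pts" "length gs = k"
  shows "tuple_dist upower k (map cls fs) (map cls gs) = (\<Sum>i<k. (1/2) ^ i * udist (fs ! i) (gs ! i))"
  unfolding tuple_dist_def using assms by (intro sum.cong refl) (auto simp: mdist_upower subset_iff)

text \<open>
  A function \<open>h\<close> into the naturals that tends to infinity along \<open>U\<close> makes the ultrafilter countably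
  incomplete, and allows a diagonal argument: with \<open>f k\<close> representing the \<open>k\<close>-th term of a Cauchy
  sequence, the limit is represented by \<open>s \<mapsto> f (m s) s\<close>, where \<open>m s\<close> is the largest \<open>k \<le> h s\<close> such that the
  distances between the first terms at the index \<open>s\<close> are nearly their limits.
\<close>
lemma mcomplete_upower:
  fixes h :: "'i \<Rightarrow> nat"
  assumes h: "filterlim h at_top U"
  shows "mcomplete_of (met upower)"
proof -
  interpret N: Metric_space "cls ` pts" cdist
    by (rule Metric_space_upower)
  have "\<exists>A. limitin N.mtopology \<sigma> A sequentially" if \<sigma>: "N.MCauchy \<sigma>" for \<sigma>
  proof -
    have "\<sigma> k \<in> cls ` pts" for k
      using \<sigma> by (simp add: N.MCauchy_def image_subset_iff)
    then have "\<forall>k. \<exists>f\<in>pts. \<sigma> k = cls f"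
      by (simp add: image_iff)
    then obtain f where f: "\<And>k. f k \<in> pts" and \<sigma>f: "\<And>k. \<sigma> k = cls (f k)"
      by metis
    define Q where "Q = (\<lambda>k s. k \<le> h s \<and>
      (\<forall>i\<le>k. \<forall>j\<le>k. d (f i s) (f j s) < udist (f i) (f j) + inverse (Suc k)))"
    have ev: "\<forall>\<^sub>F s in U. Q k s" for k
      unfolding Q_def
    proof (intro eventually_conj)
      show "\<forall>\<^sub>F s in U. k \<le> h s"
        using h by (simp add: filterlim_at_top)
      have "\<forall>\<^sub>F s in U. d (f i s) (f j s) < udist (f i) (f j) + inverse (Suc k)" for i j
        using udist_tendsto[OF f f, of i j] by (rule order_tendstoD) simp
      then have "\<forall>\<^sub>F s in U. \<forall>i\<in>{..k}. \<forall>j\<in>{..k}. d (f i s) (f j s) < udist (f i) (f j) + inverse (Suc k)"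
        by (intro eventually_ball_finite finite_atMost ballI)
      then show "\<forall>\<^sub>F s in U. \<forall>i\<le>k. \<forall>j\<le>k. d (f i s) (f j s) < udist (f i) (f j) + inverse (Suc k)"
        by (rule eventually_mono) auto
    qed
    define m where "m = (\<lambda>s. GREATEST k. Q k s)"
    define g where "g = (\<lambda>s. f (m s) s)"
    have g: "g \<in> pts"
      using f by (simp add: g_def pts_def)
    have m: "Q (m s) s \<and> k \<le> m s" if "Q k s" for k s
    proof -
      have b: "\<And>j. Q j s \<Longrightarrow> j \<le> h s" by (simp add: Q_def)
      show ?thesis
        unfolding m_def using GreatestI_nat[of "\<lambda>k. Q k s", OF that b] Greatest_le_nat[of "\<lambda>k. Q k s", OF that b]
        by blast
    qed
    have "limitin N.mtopology \<sigma> (cls g) sequentially"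
      unfolding N.limit_metric_sequentially
    proof (intro conjI allI impI)
      show "cls g \<in> cls ` pts" using g by auto
      fix \<epsilon> :: real assume "0 < \<epsilon>"
      then have "0 < \<epsilon> / 3" by simp
      then obtain k0 where k0: "\<And>i j. k0 \<le> i \<Longrightarrow> k0 \<le> j \<Longrightarrow> cdist (\<sigma> i) (\<sigma> j) < \<epsilon> / 3"
        using \<sigma> unfolding N.MCauchy_def by meson
      obtain k1 where k1: "inverse (real (Suc k1)) < \<epsilon> / 3"
        using \<open>0 < \<epsilon> / 3\<close> reals_Archimedean by blast
      have "cdist (\<sigma> i) (cls g) < \<epsilon>" if i: "max k0 k1 \<le> i" for i
      proof -
        have "d (f i s) (g s) \<le> \<epsilon> / 3 + \<epsilon> / 3" if "Q i s" for s
        proof -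
          from m[OF that] have "Q (m s) s" "i \<le> m s" by auto
          then have "d (f i s) (g s) < udist (f i) (f (m s)) + inverse (Suc (m s))"
            by (simp add: Q_def g_def)
          moreover have "udist (f i) (f (m s)) < \<epsilon> / 3"
            using k0[of i "m s"] i \<open>i \<le> m s\<close> f by (simp add: \<sigma>f cdist_cls)
          moreover have "inverse (real (Suc (m s))) \<le> inverse (real (Suc k1))"
            using i \<open>i \<le> m s\<close> by (intro le_imp_inverse_le) auto
          ultimately show ?thesis using k1 by linarith
        qed
        then have "\<forall>\<^sub>F s in U. d (f i s) (g s) \<le> \<epsilon> / 3 + \<epsilon> / 3"
          using ev[of i] by (auto elim: eventually_mono)
        then have "udist (f i) g \<le> \<epsilon> / 3 + \<epsilon> / 3"
          by (rule tendsto_upperbound[OF udist_tendsto[OF f g] _ nontriv])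
        then show ?thesis
          using f g \<open>0 < \<epsilon>\<close> by (simp add: \<sigma>f cdist_cls)
      qed
      then show "\<exists>K. \<forall>i\<ge>K. \<sigma> i \<in> cls ` pts \<and> cdist (\<sigma> i) (cls g) < \<epsilon>"
        using f by (intro exI[of _ "max k0 k1"]) (auto simp: \<sigma>f)
    qed
    then show ?thesis ..
  qed
  then have "N.mcomplete"
    by (simp add: N.mcomplete_def)
  then show ?thesis
    unfolding mcomplete_of_def upower_def by simp
qed

lemma is_struct_upower:
  fixes h :: "'i \<Rightarrow> nat"
  assumes "filterlim h at_top U"
  shows "is_struct L upower"
proof -
  have "pts \<noteq> {}"
    using M by (auto simp: pts_def is_struct_def intro: exI[of _ "\<lambda>_. _"])
  moreover have "udist f g \<le> 1" if "f \<in> pts" "g \<in> pts" for f g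
    using M that by (intro tendsto_upperbound[OF udist_tendsto _ nontriv]) (auto simp: is_struct_def pts_def)
  moreover have "cst_int upower c \<in> cls ` pts" if "c \<in> consts_of L" for c
    using M that by (auto simp: upower_def is_struct_def pts_def)
  moreover have "fun_int upower F A \<in> cls ` pts"
    if "F \<in> funs_of L" "A \<in> tuples upower (fun_ar L F)" for F A
    using that fun_int_upower fun_at_pts by (auto elim!: tuples_upowerE)
  moreover have "mdist (met upower) (fun_int upower F A) (fun_int upower F B)
      \<le> fun_lip L F * tuple_dist upower (fun_ar L F) A B"
    if F: "F \<in> funs_of L" and "A \<in> tuples upower (fun_ar L F)" "B \<in> tuples upower (fun_ar L F)" for F A B
    using that fun_at_lipschitz[OF F]
    by (auto simp: fun_int_upower fun_at_pts mdist_upower tuple_dist_upower elim!: tuples_upowerE)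
  moreover have "\<bar>rel_int upower R A\<bar> \<le> 1"
    if R: "R \<in> rels_of L" and A: "A \<in> tuples upower (rel_ar L R)" for R A
  proof -
    obtain fs where fs: "A = map cls fs" "set fs \<subseteq> pts" "length fs = rel_ar L R"
      using A by (rule tuples_upowerE)
    have "\<bar>Lim U (\<lambda>s. rel_int M R (map (\<lambda>f. f s) fs))\<bar> \<le> 1"
      using M R tuple_at[OF fs(2,3)]
      by (intro tendsto_upperbound[OF tendsto_rabs[OF rel_at_tendsto[OF R fs(2,3)]] _ nontriv])
        (simp add: is_struct_def)
    then show ?thesis
      using fs R by (simp add: rel_int_upower)
  qed
  moreover have "\<bar>rel_int upower R A - rel_int upower R B\<bar>
      \<le> rel_lip L R * tuple_dist upower (rel_ar L R) A B"
    if R: "R \<in> rels_of L" and "A \<in> tuples upower (rel_ar L R)" "B \<in> tuples upower (rel_ar L R)" for R A B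
    using that rel_at_lipschitz[OF R]
    by (auto simp: rel_int_upower tuple_dist_upower elim!: tuples_upowerE)
  ultimately show ?thesis
    unfolding is_struct_def mspace_upower
    using mcomplete_upower[OF assms] by (auto simp: mdist_upower)
qed

lemma tm_val_upower:
  assumes e: "\<And>v. e v \<in> pts"
  shows "tm_in L t \<Longrightarrow> tm_val upower (\<lambda>v. cls (e v)) t = cls (\<lambda>s. tm_val M (\<lambda>v. e v s) t)"
proof (induction t)
  case (TVar v)
  then show ?case by simp
next
  case (TCst c)
  then show ?case by (simp add: upower_def)
next
  case (TFun F ts)
  let ?fs = "map (\<lambda>t s. tm_val M (\<lambda>v. e v s) t) ts"
  have fs: "set ?fs \<subseteq> pts" "length ?fs = fun_ar L F"
    using TFun.prems e by (auto simp: pts_def intro!: tm_val_in_mspace[OF M])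
  have "map (tm_val upower (\<lambda>v. cls (e v))) ts = map cls ?fs"
    using TFun by simp
  then have "tm_val upower (\<lambda>v. cls (e v)) (TFun F ts) = fun_int upower F (map cls ?fs)"
    by (simp only: tm_val.simps)
  also have "\<dots> = cls (\<lambda>s. tm_val M (\<lambda>v. e v s) (TFun F ts))"
    using fun_int_upower[OF _ fs] TFun.prems by (simp add: comp_def)
  finally show ?case .
qed

text \<open>
  The value of the supremum at the index \<open>s\<close> is nearly attained at some \<open>f s\<close>, and the class of \<open>f\<close> is a
  point of the ultrapower at which the supremum there is nearly as large as the limit.
\<close>
lemma los_sup:
  assumes \<phi>: "fm_in L \<phi>" and e: "\<And>v. e v \<in> pts"
    and IH: "\<And>e. (\<And>v. e v \<in> pts) \<Longrightarrow>
      ((\<lambda>s. fm_val M \<phi> (\<lambda>v. e v s)) \<longlongrightarrow> fm_val upower \<phi> (\<lambda>v. cls (e v))) U"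
  shows "((\<lambda>s. fm_val M (FSup w \<phi>) (\<lambda>v. e v s)) \<longlongrightarrow> fm_val upower (FSup w \<phi>) (\<lambda>v. cls (e v))) U"
proof -
  define g where "g = (\<lambda>s. fm_val M (FSup w \<phi>) (\<lambda>v. e v s))"
  let ?N = "fm_val upower (FSup w \<phi>) (\<lambda>v. cls (e v))"
  have lim: "((\<lambda>s. fm_val M \<phi> ((\<lambda>v. e v s)(w := f s))) \<longlongrightarrow>
      fm_val upower \<phi> ((\<lambda>v. cls (e v))(w := cls f))) U" if f: "f \<in> pts" for f
  proof -
    have eq: "(\<lambda>v. (e(w := f)) v s) = (\<lambda>v. e v s)(w := f s)" for s
      by auto
    have eq': "(\<lambda>v. cls ((e(w := f)) v)) = (\<lambda>v. cls (e v))(w := cls f)"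
      by (simp add: fun_eq_iff)
    have "((\<lambda>s. fm_val M \<phi> (\<lambda>v. (e(w := f)) v s)) \<longlongrightarrow> fm_val upower \<phi> (\<lambda>v. cls ((e(w := f)) v))) U"
      by (rule IH) (simp add: e f)
    then show ?thesis
      unfolding eq eq' .
  qed
  have ne: "mspace (met M) \<noteq> {}"
    using M by (simp add: is_struct_def)
  obtain C where C: "\<And>e. \<forall>v. e v \<in> mspace (met M) \<Longrightarrow> \<bar>fm_val M \<phi> e\<bar> \<le> C"
    using fm_val_bounded[OF M \<phi>] by blast
  have C': "\<bar>fm_val M \<phi> ((\<lambda>v. e v s)(w := x))\<bar> \<le> C" if "x \<in> mspace (met M)" for x s
    using e that by (intro C) (auto simp: pts_def)
  have bdd: "bdd_above ((\<lambda>x. fm_val M \<phi> ((\<lambda>v. e v s)(w := x))) ` mspace (met M))" for s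
    using C'[of _ s] by (intro bdd_aboveI2[of _ _ C]) (force simp: abs_le_iff)
  have "\<bar>g s\<bar> \<le> C" for s
    using C' ne by (auto simp: g_def intro!: cSup_abs_le)
  then have g: "(g \<longlongrightarrow> Lim U g) U"
    by (rule tendsto_ultralimit[OF U])
  have up: "fm_val upower \<phi> ((\<lambda>v. cls (e v))(w := cls f)) \<le> Lim U g" if f: "f \<in> pts" for f
    using f bdd by (intro tendsto_le[OF nontriv g lim[OF f]])
      (auto simp: g_def pts_def intro!: always_eventually cSUP_upper)
  have bddN: "bdd_above ((\<lambda>A. fm_val upower \<phi> ((\<lambda>v. cls (e v))(w := A))) ` cls ` pts)"
    using up by (intro bdd_aboveI2[of _ _ "Lim U g"]) blast
  have "pts \<noteq> {}"
    using e by auto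
  then have "?N \<le> Lim U g"
    unfolding fm_val.simps mspace_upower using up by (intro cSUP_least) auto
  moreover have "Lim U g - \<epsilon> \<le> ?N" if \<epsilon>: "0 < \<epsilon>" for \<epsilon>
  proof -
    have "\<exists>x\<in>mspace (met M). g s - \<epsilon> < fm_val M \<phi> ((\<lambda>v. e v s)(w := x))" for s
      using less_cSUP_iff[OF ne bdd, of "g s - \<epsilon>" s] \<epsilon> by (simp add: g_def)
    then obtain f where f: "\<And>s. f s \<in> mspace (met M)"
        "\<And>s. g s - \<epsilon> < fm_val M \<phi> ((\<lambda>v. e v s)(w := f s))"
      by metis
    then have fp: "f \<in> pts"
      by (simp add: pts_def)
    have "Lim U g - \<epsilon> \<le> fm_val upower \<phi> ((\<lambda>v. cls (e v))(w := cls f))"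
      using f(2) by (intro tendsto_le[OF nontriv lim[OF fp] tendsto_diff[OF g tendsto_const]])
        (intro always_eventually allI less_imp_le)
    also have "\<dots> \<le> ?N"
      unfolding fm_val.simps mspace_upower by (intro cSUP_upper imageI fp bddN)
    finally show ?thesis .
  qed
  ultimately have "?N = Lim U g"
    by (metis antisym diff_le_eq field_le_epsilon)
  then have "(g \<longlongrightarrow> ?N) U"
    using g by (simp only:)
  then show ?thesis
    unfolding g_def .
qed

lemma fm_val_FInf: "fm_val N (FInf w \<phi>) e = - fm_val N (FSup w (FScale (-1) \<phi>)) e"
  by (simp add: Inf_real_def image_image)

text \<open>
  The theorem of Los for continuous logic.  Atomic formulas have the asserted limits by construction
  of the ultrapower, connectives are continuous, and \<open>FInf\<close> reduces to \<open>FSup\<close> by negation.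
\<close>
theorem los:
  assumes "fm_in L \<phi>" "\<And>v. e v \<in> pts"
  shows "((\<lambda>s. fm_val M \<phi> (\<lambda>v. e v s)) \<longlongrightarrow> fm_val upower \<phi> (\<lambda>v. cls (e v))) U"
  using assms
proof (induction \<phi> arbitrary: e)
  case (FReal r)
  then show ?case by simp
next
  case (FDist t u)
  have p: "(\<lambda>s. tm_val M (\<lambda>v. e v s) t) \<in> pts" "(\<lambda>s. tm_val M (\<lambda>v. e v s) u) \<in> pts"
    using FDist by (auto simp: pts_def intro!: tm_val_in_mspace[OF M])
  then show ?case
    using FDist udist_tendsto[OF p] by (simp add: tm_val_upower mdist_upower)
next
  case (FRel R ts)
  let ?fs = "map (\<lambda>t s. tm_val M (\<lambda>v. e v s) t) ts"
  have fs: "set ?fs \<subseteq> pts" "length ?fs = rel_ar L R" and R: "R \<in> rels_of L"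
    using FRel by (auto simp: pts_def intro!: tm_val_in_mspace[OF M])
  have eq: "map (tm_val upower (\<lambda>v. cls (e v))) ts = map cls ?fs"
    using FRel by (auto simp: tm_val_upower)
  show ?case
    unfolding fm_val.simps eq rel_int_upower[OF R fs]
    using rel_at_tendsto[OF R fs] by (simp add: comp_def)
next
  case (FSup w \<phi>)
  then show ?case by (intro los_sup) auto
next
  case (FInf w \<phi>)
  have "((\<lambda>s. fm_val M (FSup w (FScale (-1) \<phi>)) (\<lambda>v. e v s)) \<longlongrightarrow>
      fm_val upower (FSup w (FScale (-1) \<phi>)) (\<lambda>v. cls (e v))) U"
    using FInf by (intro los_sup) (auto intro!: tendsto_minus)
  then show ?case
    unfolding fm_val_FInf by (rule tendsto_minus)
qed (auto intro!: tendsto_intros)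

text \<open>
  The constant is the limit of \<open>f\<close> along the ultrafilter.  If no point were a limit, finitely many balls
  that \<open>f\<close> eventually avoids would cover \<open>M\<close>.
\<close>
lemma compact_near_constant:
  assumes "compact_space (mtopology_of (met M))" and f: "f \<in> pts"
  shows "\<exists>l\<in>mspace (met M). udist f (\<lambda>_. l) = 0"
proof (rule ccontr)
  interpret MM: Metric_space "mspace (met M)" d
    by simp
  assume "\<not> ?thesis"
  then have pos: "0 < udist f (\<lambda>_. l)" if "l \<in> mspace (met M)" for l
    using that udist_nonneg[OF f, of "\<lambda>_. l"] by (force simp: pts_def)
  define B where "B = (\<lambda>l. MM.mball l (udist f (\<lambda>_. l) / 2))"
  have cpt: "compactin MM.mtopology (mspace (met M))"
    using assms(1) by (simp add: compact_space_def mtopology_of_def)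
  have cover: "mspace (met M) \<subseteq> \<Union> (B ` mspace (met M))"
    using pos by (force simp: B_def)
  have "\<exists>\<F>. finite \<F> \<and> \<F> \<subseteq> B ` mspace (met M) \<and> mspace (met M) \<subseteq> \<Union> \<F>"
    by (rule compactinD[OF cpt _ cover]) (auto simp: B_def)
  then obtain K where K: "finite K" "K \<subseteq> mspace (met M)" "mspace (met M) \<subseteq> \<Union> (B ` K)"
    by (metis finite_subset_image)
  have "\<forall>\<^sub>F s in U. udist f (\<lambda>_. l) / 2 < d (f s) l" if "l \<in> mspace (met M)" for l
    using that pos[OF that] f
    by (intro order_tendstoD(1)[OF udist_tendsto[of f "\<lambda>_. l"]]) (auto simp: pts_def)
  then have "\<forall>\<^sub>F s in U. \<forall>l\<in>K. udist f (\<lambda>_. l) / 2 < d (f s) l"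
    using K by (intro eventually_ball_finite) auto
  then obtain s where s: "\<forall>l\<in>K. udist f (\<lambda>_. l) / 2 < d (f s) l"
    using eventually_happens'[OF nontriv] by blast
  have "f s \<in> mspace (met M)"
    using f by (simp add: pts_def)
  then obtain l where l: "l \<in> K" "f s \<in> B l"
    using K(3) by auto
  then have "d l (f s) < udist f (\<lambda>_. l) / 2"
    by (simp add: B_def)
  then show False
    using s l(1) by (force simp: mdist_commute[of "met M" l])
qed

end

section \<open>Types of a complete affine theory\<close>

text \<open>
  Closing a formula under infima reduces statements about all tuples to a sentence, to which
  completeness of the theory applies.
\<close>
lemma foldr_FInf_affine_fms:
  assumes "\<phi> \<in> affine_fms L n"
  shows "foldr FInf [0..<n] \<phi> \<in> affine_fms L 0"
proof -
  have "fm_in L (foldr FInf vs \<phi>)" "affine_fm (foldr FInf vs \<phi>)"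
    "free_vars (foldr FInf vs \<phi>) = free_vars \<phi> - set vs" for vs
    using assms by (induction vs) (auto simp: affine_fms_def cl_fms_def)
  then show ?thesis
    using assms by (auto simp: affine_fms_def cl_fms_def)
qed

lemma foldr_FInf_lower:
  assumes N: "is_struct L N" and \<phi>: "fm_in L \<phi>" and e: "\<And>v. e v \<in> mspace (met N)"
  shows "fm_val N (foldr FInf vs \<phi>) e \<le> fm_val N \<phi> e"
proof (induction vs)
  case (Cons v vs)
  let ?\<psi> = "foldr FInf vs \<phi>"
  have "fm_in L ?\<psi>"
    using \<phi> by (induction vs) auto
  then obtain C where "\<forall>e. (\<forall>v. e v \<in> mspace (met N)) \<longrightarrow> \<bar>fm_val N ?\<psi> e\<bar> \<le> C"
    using fm_val_bounded[OF N] by blast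
  then have "\<bar>fm_val N ?\<psi> (e(v := x))\<bar> \<le> C" if "x \<in> mspace (met N)" for x
    using e that by simp
  then have "bdd_below ((\<lambda>x. fm_val N ?\<psi> (e(v := x))) ` mspace (met N))"
    by (intro bdd_belowI2[of _ "- C"]) (simp add: abs_le_iff minus_le_iff)
  then have "fm_val N (FInf v ?\<psi>) e \<le> fm_val N ?\<psi> (e(v := e v))"
    unfolding fm_val.simps by (intro cINF_lower e)
  then show ?case
    using Cons by simp
qed simp

lemma foldr_FInf_nonneg:
  assumes N: "mspace (met N) \<noteq> {}"
    and pos: "\<And>e. (\<And>v. e v \<in> mspace (met N)) \<Longrightarrow> 0 \<le> fm_val N \<phi> e"
  shows "(\<And>v. e v \<in> mspace (met N)) \<Longrightarrow> 0 \<le> fm_val N (foldr FInf vs \<phi>) e"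
proof (induction vs arbitrary: e)
  case Nil
  then show ?case using pos by simp
next
  case (Cons v vs)
  then have "0 \<le> fm_val N (foldr FInf vs \<phi>) (e(v := x))" if "x \<in> mspace (met N)" for x
    using that by (intro Cons.IH) auto
  then show ?case
    using N by (auto intro!: cINF_greatest)
qed

text \<open>
  \<^const>\<open>val\<close> reads a list beyond its end, where the values may lie outside the structure.
  Results about assignments into a structure are applied to this extension instead.
\<close>
definition assign :: "'m \<Rightarrow> 'm list \<Rightarrow> nat \<Rightarrow> 'm" where
  "assign x a i = (if i < length a then a ! i else x)"

lemma assign_in_mspace:
  "x \<in> mspace (met M) \<Longrightarrow> a \<in> tuples M n \<Longrightarrow> assign x a i \<in> mspace (met M)"
  by (auto simp: assign_def tuples_def)

lemma val_eq_assign: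
  "\<phi> \<in> cl_fms L n \<Longrightarrow> a \<in> tuples M n \<Longrightarrow> val M \<phi> a = fm_val M \<phi> (assign x a)"
  by (rule val_eq_fm_val) (auto simp: assign_def tuples_def)

text \<open>
  The infimum of \<open>\<psi> - \<phi>\<close> over all tuples is the value of an affine sentence, and this value is the
  same in all models of a complete theory.
\<close>
lemma complete_theory_entails:
  fixes M :: "('c, 'f, 'r, 'm) struct"
  assumes T: "complete_theory TYPE('m) L T" and M: "models L M T"
    and \<phi>: "\<phi> \<in> affine_fms L n" and \<psi>: "\<psi> \<in> affine_fms L n"
    and le: "\<And>a. a \<in> tuples M n \<Longrightarrow> val M \<phi> a \<le> val M \<psi> a"
  shows "entails_le TYPE('m) L T n \<phi> \<psi>"
  unfolding entails_le_def
proof (intro allI impI ballI)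
  fix N :: "('c, 'f, 'r, 'm) struct" and a
  assume N: "models L N T" and a: "a \<in> tuples N n"
  define \<delta> where "\<delta> = FAdd \<psi> (FScale (-1) \<phi>)"
  define \<sigma> where "\<sigma> = foldr FInf [0..<n] \<delta>"
  have \<delta>: "\<delta> \<in> affine_fms L n"
    using \<phi> \<psi> by (auto simp: \<delta>_def affine_fms_def cl_fms_def)
  then have \<sigma>: "\<sigma> \<in> affine_fms L 0"
    unfolding \<sigma>_def by (rule foldr_FInf_affine_fms)
  then obtain r where r: "entails_eq TYPE('m) L T 0 \<sigma> (FReal r)"
    using T by (auto simp: complete_theory_def)
  have \<sigma>_val: "fm_val K \<sigma> e = r" if "models L K T" for K :: "('c, 'f, 'r, 'm) struct" and e
  proof -
    have "val K \<sigma> [] = r"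
      using r that by (force simp: entails_eq_def entails_le_def tuples_def val_def)
    moreover have "val K \<sigma> [] = fm_val K \<sigma> e"
      using \<sigma> by (intro val_eq_fm_val) (auto simp: affine_fms_def)
    ultimately show ?thesis by simp
  qed
  have neM: "mspace (met M) \<noteq> {}" and sN: "is_struct L N"
    using M N by (auto simp: models_def is_struct_def)
  then obtain x where x: "x \<in> mspace (met M)" by auto
  have "0 \<le> fm_val M \<delta> e" if e: "\<And>v. e v \<in> mspace (met M)" for e
  proof -
    have "map e [0..<n] \<in> tuples M n"
      using e by (auto simp: tuples_def)
    then have "0 \<le> val M \<delta> (map e [0..<n])"
      using le by (simp add: \<delta>_def val_def)
    moreover have "val M \<delta> (map e [0..<n]) = fm_val M \<delta> e"
      using \<delta> by (intro val_eq_fm_val) (auto simp: affine_fms_def)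
    ultimately show ?thesis by simp
  qed
  then have "0 \<le> fm_val M \<sigma> (\<lambda>_. x)"
    unfolding \<sigma>_def using x by (intro foldr_FInf_nonneg[OF neM]) auto
  then have "0 \<le> r"
    using \<sigma>_val[OF M] by simp
  obtain y where y: "y \<in> mspace (met N)"
    using sN by (auto simp: is_struct_def)
  have "fm_val N \<sigma> (assign y a) \<le> fm_val N \<delta> (assign y a)"
    unfolding \<sigma>_def using \<delta> assign_in_mspace[OF y a]
    by (intro foldr_FInf_lower[OF sN]) (auto simp: affine_fms_def cl_fms_def)
  then have "0 \<le> val N \<delta> a"
    using \<open>0 \<le> r\<close> \<sigma>_val[OF N] val_eq_assign[OF _ a, of \<delta> L y] \<delta> by (simp add: affine_fms_def)
  then show "val N \<phi> a \<le> val N \<psi> a"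
    by (simp add: \<delta>_def val_def)
qed

lemma fm_class_eq_iff:
  fixes M :: "('c, 'f, 'r, 'm) struct"
  assumes T: "complete_theory TYPE('m) L T" and M: "models L M T"
    and \<phi>: "\<phi> \<in> affine_fms L n" and \<psi>: "\<psi> \<in> affine_fms L n"
  shows "fm_class TYPE('m) L T n \<phi> = fm_class TYPE('m) L T n \<psi> \<longleftrightarrow>
    (\<forall>a\<in>tuples M n. val M \<phi> a = val M \<psi> a)"
proof -
  have mem: "\<theta> \<in> fm_class TYPE('m) L T n \<eta> \<longleftrightarrow>
      \<theta> \<in> affine_fms L n \<and> (\<forall>a\<in>tuples M n. val M \<eta> a = val M \<theta> a)"
    if "\<eta> \<in> affine_fms L n" for \<eta> \<theta>
  proof
    assume "\<theta> \<in> fm_class TYPE('m) L T n \<eta>"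
    then show "\<theta> \<in> affine_fms L n \<and> (\<forall>a\<in>tuples M n. val M \<eta> a = val M \<theta> a)"
      using M by (fastforce simp: fm_class_def T_equiv_def entails_eq_def entails_le_def intro: antisym)
  next
    assume "\<theta> \<in> affine_fms L n \<and> (\<forall>a\<in>tuples M n. val M \<eta> a = val M \<theta> a)"
    then show "\<theta> \<in> fm_class TYPE('m) L T n \<eta>"
      using that by (auto simp: fm_class_def T_equiv_def entails_eq_def intro!: complete_theory_entails[OF T M])
  qed
  show ?thesis
    using mem[OF \<phi>] mem[OF \<psi>] \<phi> \<psi> by (auto simp: set_eq_iff)
qed

definition affine_funs :: "('c, 'f, 'r) lang \<Rightarrow> ('c, 'f, 'r, 'm) struct \<Rightarrow> nat \<Rightarrow> ('m list \<Rightarrow> real) set" where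
  "affine_funs L M n = {f. \<exists>\<phi>\<in>affine_fms L n. \<forall>a\<in>tuples M n. f a = val M \<phi> a}"

lemma fun_subspace_affine_funs: "fun_subspace (affine_funs L M n)"
  unfolding fun_subspace_def
proof (intro conjI ballI allI)
  show "(\<lambda>_. 1) \<in> affine_funs L M n"
    unfolding affine_funs_def
    by (intro CollectI bexI[of _ "FReal 1"]) (auto simp: affine_fms_def cl_fms_def val_def)
next
  fix f g assume "f \<in> affine_funs L M n" "g \<in> affine_funs L M n"
  then obtain \<phi> \<psi> where "\<phi> \<in> affine_fms L n" "\<forall>a\<in>tuples M n. f a = val M \<phi> a"
    "\<psi> \<in> affine_fms L n" "\<forall>a\<in>tuples M n. g a = val M \<psi> a"
    by (auto simp: affine_funs_def)
  then show "(\<lambda>x. f x + g x) \<in> affine_funs L M n"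
    unfolding affine_funs_def
    by (intro CollectI bexI[of _ "FAdd \<phi> \<psi>"]) (auto simp: affine_fms_def cl_fms_def val_def)
next
  fix c f assume "f \<in> affine_funs L M n"
  then obtain \<phi> where "\<phi> \<in> affine_fms L n" "\<forall>a\<in>tuples M n. f a = val M \<phi> a"
    by (auto simp: affine_funs_def)
  then show "(\<lambda>x. c * f x) \<in> affine_funs L M n"
    unfolding affine_funs_def
    by (intro CollectI bexI[of _ "FScale c \<phi>"]) (auto simp: affine_fms_def cl_fms_def val_def)
qed

lemma affine_funs_bounded:
  assumes M: "is_struct L M"
  shows "affine_funs L M n \<subseteq> bounded_funs (tuples M n)"
proof
  fix f assume "f \<in> affine_funs L M n"
  then obtain \<phi> where \<phi>: "\<phi> \<in> affine_fms L n" "\<forall>a\<in>tuples M n. f a = val M \<phi> a"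
    by (auto simp: affine_funs_def)
  obtain x where x: "x \<in> mspace (met M)"
    using M by (auto simp: is_struct_def)
  obtain C where C: "\<forall>e. (\<forall>v. e v \<in> mspace (met M)) \<longrightarrow> \<bar>fm_val M \<phi> e\<bar> \<le> C"
    using fm_val_bounded[OF M, of \<phi>] \<phi>(1) by (auto simp: affine_fms_def cl_fms_def)
  have "\<bar>f a\<bar> \<le> C" if a: "a \<in> tuples M n" for a
    using C \<phi> a val_eq_assign[OF _ a, of \<phi> L x] assign_in_mspace[OF x a] by (auto simp: affine_fms_def)
  then show "f \<in> bounded_funs (tuples M n)"
    by (auto simp: bounded_funs_def)
qed

text \<open>
  Types correspond to states on \<^const>\<open>affine_funs\<close> by \<open>\<rho> (val M \<phi>) = p [\<phi>]\<close>.  Under this correspondence an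
  extreme type is an extreme state, to which \<open>extreme_state_approx\<close> applies.
\<close>
lemma extreme_type_approx:
  fixes M :: "('c, 'f, 'r, 'm) struct"
  assumes T: "complete_theory TYPE('m) L T" and M: "models L M T"
    and p: "p \<in> extreme_types TYPE('m) L T n"
    and F: "finite F" "F \<subseteq> affine_fms L n" and \<epsilon>: "0 < \<epsilon>"
  shows "\<exists>a\<in>tuples M n. \<forall>\<phi>\<in>F. \<bar>val M \<phi> a - p (fm_class TYPE('m) L T n \<phi>)\<bar> < \<epsilon>"
proof -
  let ?X = "tuples M n" and ?V = "affine_funs L M n" and ?A = "affine_fms L n"
  let ?c = "fm_class TYPE('m) L T n"
  have sM: "is_struct L M"
    using M by (simp add: models_def)
  have V: "fun_subspace ?V"
    by (rule fun_subspace_affine_funs)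
  have bV: "?V \<subseteq> bounded_funs ?X"
    by (rule affine_funs_bounded[OF sM])
  have AV: "val M \<phi> \<in> ?V" if "\<phi> \<in> ?A" for \<phi>
    using that by (auto simp: affine_funs_def)
  have A_add: "FAdd \<phi> \<psi> \<in> ?A" if "\<phi> \<in> ?A" "\<psi> \<in> ?A" for \<phi> \<psi>
    using that by (auto simp: affine_fms_def cl_fms_def)
  have A_scale: "FScale c \<phi> \<in> ?A" if "\<phi> \<in> ?A" for c \<phi>
    using that by (auto simp: affine_fms_def cl_fms_def)
  have A_real: "FReal c \<in> ?A" for c
    by (auto simp: affine_fms_def cl_fms_def)
  have class_D: "?c \<phi> \<in> D_space TYPE('m) L T n" if "\<phi> \<in> ?A" for \<phi>
    using that by (auto simp: D_space_def fm_class_def quotient_def)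
  have pt: "p \<in> affine_types TYPE('m) L T n"
    using p by (simp add: extreme_types_def)
  define \<rho> where "\<rho> = (\<lambda>f. p (?c (SOME \<phi>. \<phi> \<in> ?A \<and> (\<forall>a\<in>?X. f a = val M \<phi> a))))"
  have \<rho>: "\<rho> f = p (?c \<phi>)" if "\<phi> \<in> ?A" "\<forall>a\<in>?X. f a = val M \<phi> a" for f \<phi>
  proof -
    \<comment> \<open>Two affine formulas with the same values on \<open>?X\<close> have the same class, so the choice is harmless.\<close>
    let ?\<phi> = "SOME \<phi>. \<phi> \<in> ?A \<and> (\<forall>a\<in>?X. f a = val M \<phi> a)"
    have "?\<phi> \<in> ?A \<and> (\<forall>a\<in>?X. f a = val M ?\<phi> a)"
      by (rule someI[of _ \<phi>]) (use that in auto)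
    then have "?c ?\<phi> = ?c \<phi>"
      using that by (subst fm_class_eq_iff[OF T M]) auto
    then show ?thesis by (simp add: \<rho>_def)
  qed
  have \<rho>_val: "\<rho> (val M \<phi>) = p (?c \<phi>)" if "\<phi> \<in> ?A" for \<phi>
    using that by (intro \<rho>) auto
  have "state ?X ?V \<rho>"
    unfolding state_def linear_fun_def
  proof (intro conjI ballI allI impI)
    fix f g assume "f \<in> ?V" "g \<in> ?V"
    then obtain \<phi> \<psi> where \<phi>: "\<phi> \<in> ?A" "\<forall>a\<in>?X. f a = val M \<phi> a"
      and \<psi>: "\<psi> \<in> ?A" "\<forall>a\<in>?X. g a = val M \<psi> a"
      by (auto simp: affine_funs_def)
    have "\<rho> (\<lambda>x. f x + g x) = p (?c (FAdd \<phi> \<psi>))"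
      using \<phi> \<psi> by (intro \<rho> A_add) (auto simp: val_def)
    then show "\<rho> (\<lambda>x. f x + g x) = \<rho> f + \<rho> g"
      using pt \<phi> \<psi> \<rho>[OF \<phi>] \<rho>[OF \<psi>] by (simp add: affine_types_def)
  next
    fix c f assume "f \<in> ?V"
    then obtain \<phi> where \<phi>: "\<phi> \<in> ?A" "\<forall>a\<in>?X. f a = val M \<phi> a"
      by (auto simp: affine_funs_def)
    have "\<rho> (\<lambda>x. c * f x) = p (?c (FScale c \<phi>))"
      using \<phi> by (intro \<rho> A_scale) (auto simp: val_def)
    then show "\<rho> (\<lambda>x. c * f x) = c * \<rho> f"
      using pt \<phi> \<rho>[OF \<phi>] by (simp add: affine_types_def)
  next
    fix f assume "f \<in> ?V" and pos: "\<forall>a\<in>?X. 0 \<le> f a"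
    then obtain \<phi> where \<phi>: "\<phi> \<in> ?A" "\<forall>a\<in>?X. f a = val M \<phi> a"
      by (auto simp: affine_funs_def)
    have "entails_le TYPE('m) L T n (FReal 0) \<phi>"
      using pos \<phi> A_real by (intro complete_theory_entails[OF T M]) (auto simp: val_def)
    then show "0 \<le> \<rho> f"
      using pt \<phi> \<rho>[OF \<phi>] by (simp add: affine_types_def)
  next
    have "\<rho> (\<lambda>_. 1) = p (?c (FReal 1))"
      using A_real by (intro \<rho>) (auto simp: val_def)
    then show "\<rho> (\<lambda>_. 1) = 1"
      using pt by (simp add: affine_types_def)
  qed
  moreover have "\<sigma> f = \<tau> f"
    if \<sigma>: "state ?X ?V \<sigma>" and \<tau>: "state ?X ?V \<tau>" and t: "0 < t" "t < 1"
      and dec: "\<forall>f\<in>?V. \<rho> f = (1 - t) * \<sigma> f + t * \<tau> f" and f: "f \<in> ?V" for \<sigma> \<tau> t f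
  proof -
    have cong: "\<kappa> g = \<kappa> h"
      if "state ?X ?V \<kappa>" "g \<in> ?V" "h \<in> ?V" "\<And>a. a \<in> ?X \<Longrightarrow> g a = h a" for \<kappa> g h
      using state_mono[OF V that(1,2,3)] state_mono[OF V that(1,3,2)] that(4) by (simp add: order_antisym)
    \<comment> \<open>\<open>q\<close> translates states back into types, so that extremality of \<open>p\<close> applies to \<open>q \<sigma>\<close> and \<open>q \<tau>\<close>.\<close>
    define q where "q = (\<lambda>\<kappa> :: ('m list \<Rightarrow> real) \<Rightarrow> real. restrict (\<lambda>Y. \<kappa> (val M (SOME \<phi>. \<phi> \<in> ?A \<and> ?c \<phi> = Y))) (D_space TYPE('m) L T n))"
    have q: "q \<kappa> (?c \<phi>) = \<kappa> (val M \<phi>)" if \<kappa>: "state ?X ?V \<kappa>" and \<phi>: "\<phi> \<in> ?A" for \<kappa> \<phi>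
    proof -
      define \<psi> where "\<psi> = (SOME \<psi>. \<psi> \<in> ?A \<and> ?c \<psi> = ?c \<phi>)"
      have \<psi>: "\<psi> \<in> ?A \<and> ?c \<psi> = ?c \<phi>"
        unfolding \<psi>_def by (rule someI[of _ \<phi>]) (use \<phi> in auto)
      then have "\<forall>a\<in>?X. val M \<psi> a = val M \<phi> a"
        using fm_class_eq_iff[OF T M _ \<phi>, of \<psi>] by blast
      then have "\<kappa> (val M \<psi>) = \<kappa> (val M \<phi>)"
        using \<psi> \<phi> by (intro cong[OF \<kappa>] AV) auto
      then show ?thesis
        using class_D[OF \<phi>] by (simp add: q_def \<psi>_def)
    qed
    have q_type: "q \<kappa> \<in> affine_types TYPE('m) L T n" if \<kappa>: "state ?X ?V \<kappa>" for \<kappa>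
    proof -
      have "q \<kappa> (?c (FAdd \<phi> \<psi>)) = q \<kappa> (?c \<phi>) + q \<kappa> (?c \<psi>)" if "\<phi> \<in> ?A" "\<psi> \<in> ?A" for \<phi> \<psi>
      proof -
        have "val M (FAdd \<phi> \<psi>) = (\<lambda>a. val M \<phi> a + val M \<psi> a)"
          by (auto simp: val_def)
        then show ?thesis
          using \<kappa> that AV by (simp add: q A_add state_def linear_fun_def)
      qed
      moreover have "q \<kappa> (?c (FScale c \<phi>)) = c * q \<kappa> (?c \<phi>)" if "\<phi> \<in> ?A" for c \<phi>
      proof -
        have "val M (FScale c \<phi>) = (\<lambda>a. c * val M \<phi> a)"
          by (auto simp: val_def)
        then show ?thesis
          using \<kappa> that AV by (simp add: q A_scale state_def linear_fun_def)
      qed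
      moreover have "0 \<le> q \<kappa> (?c \<phi>)" if \<phi>: "\<phi> \<in> ?A" and ent: "entails_le TYPE('m) L T n (FReal 0) \<phi>" for \<phi>
      proof -
        have "\<forall>a\<in>?X. 0 \<le> val M \<phi> a"
          using ent M by (auto simp: entails_le_def val_def)
        then show ?thesis
          using \<kappa> \<phi> AV by (simp add: q state_def)
      qed
      moreover have "q \<kappa> (?c (FReal 1)) = 1"
      proof -
        have "val M (FReal 1) = (\<lambda>a. 1)"
          by (auto simp: val_def)
        then show ?thesis
          using \<kappa> by (simp add: q A_real state_def)
      qed
      ultimately show ?thesis
        by (simp add: affine_types_def q_def)
    qed
    have "p Y = (1 - t) * q \<sigma> Y + t * q \<tau> Y" if "Y \<in> D_space TYPE('m) L T n" for Y
    proof -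
      obtain \<phi> where \<phi>: "\<phi> \<in> ?A" "Y = ?c \<phi>"
        using \<open>Y \<in> _\<close> by (auto simp: D_space_def fm_class_def quotient_def)
      then show ?thesis
        using dec AV[OF \<phi>(1)] \<rho>_val[OF \<phi>(1)] q[OF \<sigma> \<phi>(1)] q[OF \<tau> \<phi>(1)] by auto
    qed
    then have eq: "q \<sigma> = q \<tau>"
      using p t q_type[OF \<sigma>] q_type[OF \<tau>] unfolding extreme_types_def by blast
    obtain \<phi> where \<phi>: "\<phi> \<in> ?A" "\<forall>a\<in>?X. f a = val M \<phi> a"
      using f by (auto simp: affine_funs_def)
    have "\<sigma> f = \<sigma> (val M \<phi>)" "\<tau> f = \<tau> (val M \<phi>)"
      using \<phi> f by (auto intro!: cong[OF \<sigma>] cong[OF \<tau>] AV)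
    then show ?thesis
      using q[OF \<sigma> \<phi>(1)] q[OF \<tau> \<phi>(1)] eq by simp
  qed
  ultimately have ext: "extreme_state ?X ?V \<rho>"
    unfolding extreme_state_def by blast
  have "finite (val M ` F)" "val M ` F \<subseteq> ?V"
    using F AV by auto
  then have "\<exists>a\<in>?X. \<forall>f\<in>val M ` F. \<bar>f a - \<rho> f\<bar> < \<epsilon>"
    by (rule extreme_state_approx[OF V bV ext _ _ \<epsilon>])
  then show ?thesis
    using \<rho>_val F(2) by (auto simp: subset_iff)
qed

lemma infinite_fms: "infinite (UNIV :: ('c, 'f, 'r) fm set)"
proof
  assume "finite (UNIV :: ('c, 'f, 'r) fm set)"
  then have "finite (range (FReal :: real \<Rightarrow> ('c, 'f, 'r) fm))"
    by (rule finite_subset[rotated]) simp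
  then have "finite (UNIV :: real set)"
    by (rule finite_imageD) (simp add: inj_on_def)
  then show False
    by (simp add: infinite_UNIV_char_0)
qed

lemma filterlim_card_finite_subsets_at_top:
  assumes "infinite A"
  shows "filterlim card at_top (finite_subsets_at_top A)"
  unfolding filterlim_at_top
proof
  fix k
  obtain B where B: "finite B" "card B = k" "B \<subseteq> A"
    using infinite_arbitrarily_large[OF assms] by blast
  then show "\<forall>\<^sub>F S in finite_subsets_at_top A. k \<le> card S"
    unfolding eventually_finite_subsets_at_top by (intro exI[of _ B]) (auto intro: card_mono)
qed

text \<open>
  At a finite set \<open>s\<close> of formulas the assignment is correct up to \<open>1 / (card s + 1)\<close> for the affine
  formulas in \<open>s\<close>; every given \<open>\<phi>\<close> eventually belongs to \<open>s\<close>, and the error tends to \<open>0\<close>.  There are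
  infinitely many formulas, so the cardinality tends to infinity, which is what
  \<open>mcomplete_upower\<close> asks of the index set.
\<close>
lemma extreme_type_ultralimit:
  fixes M :: "('c, 'f, 'r, 'm) struct"
  assumes T: "complete_theory TYPE('m) L T" and M: "models L M T"
    and p: "p \<in> extreme_types TYPE('m) L T n"
  obtains U :: "('c, 'f, 'r) fm set filter" and e
  where "ultrafilter U" "filterlim card at_top U" "\<And>v s. e v s \<in> mspace (met M)"
    "\<And>\<phi>. \<phi> \<in> affine_fms L n \<Longrightarrow>
      ((\<lambda>s. fm_val M \<phi> (\<lambda>v. e v s)) \<longlongrightarrow> p (fm_class TYPE('m) L T n \<phi>)) U"
proof -
  let ?A = "affine_fms L n" and ?p = "\<lambda>\<phi>. p (fm_class TYPE('m) L T n \<phi>)"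
  obtain U :: "('c, 'f, 'r) fm set filter" where U: "U \<le> finite_subsets_at_top UNIV" "ultrafilter U"
    by (rule ultrafilter_below[OF finite_subsets_at_top_neq_bot])
  have card: "filterlim card at_top U"
    by (rule filterlim_mono[OF filterlim_card_finite_subsets_at_top[OF infinite_fms] order_refl U(1)])
  have ex: "\<exists>a. a \<in> tuples M n \<and>
      (finite s \<longrightarrow> (\<forall>\<phi>\<in>s \<inter> ?A. \<bar>val M \<phi> a - ?p \<phi>\<bar> < inverse (real (Suc (card s)))))" for s
  proof (cases "finite s")
    case True
    have "0 < inverse (real (Suc (card s)))"
      by simp
    from extreme_type_approx[OF T M p _ _ this, of "s \<inter> ?A"] True show ?thesis
      by blast
  next
    case False
    have "tuples M n \<noteq> {}"
      using extreme_type_approx[OF T M p, of "{}" 1] by auto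
    with False show ?thesis
      by blast
  qed
  have "\<exists>a. \<forall>s. a s \<in> tuples M n \<and>
      (finite s \<longrightarrow> (\<forall>\<phi>\<in>s \<inter> ?A. \<bar>val M \<phi> (a s) - ?p \<phi>\<bar> < inverse (real (Suc (card s)))))"
    by (intro choice allI ex)
  then obtain a where a: "\<And>s. a s \<in> tuples M n"
    and app: "\<And>s \<phi>. finite s \<Longrightarrow> \<phi> \<in> s \<Longrightarrow> \<phi> \<in> ?A \<Longrightarrow>
      \<bar>val M \<phi> (a s) - ?p \<phi>\<bar> < inverse (real (Suc (card s)))"
    by blast
  obtain x where x: "x \<in> mspace (met M)"
    using M by (auto simp: models_def is_struct_def)
  show ?thesis
  proof (rule that[OF U(2) card])
    show "assign x (a s) v \<in> mspace (met M)" for v s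
      by (rule assign_in_mspace[OF x a])
    fix \<phi> assume \<phi>: "\<phi> \<in> ?A"
    have "((\<lambda>s. val M \<phi> (a s) - ?p \<phi>) \<longlongrightarrow> 0) U"
    proof (rule Lim_null_comparison)
      show "((\<lambda>s. inverse (real (Suc (card s)))) \<longlongrightarrow> 0) U"
        by (rule filterlim_compose[OF LIMSEQ_inverse_real_of_nat card])
      have "norm (val M \<phi> (a s) - ?p \<phi>) \<le> inverse (real (Suc (card s)))" if "finite s" "\<phi> \<in> s" for s
        using app[OF that \<phi>] unfolding real_norm_def by (rule less_imp_le)
      then have "\<forall>\<^sub>F s in finite_subsets_at_top UNIV.
          norm (val M \<phi> (a s) - ?p \<phi>) \<le> inverse (real (Suc (card s)))"
        unfolding eventually_finite_subsets_at_top by (intro exI[of _ "{\<phi>}"]) blast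
      then show "\<forall>\<^sub>F s in U. norm (val M \<phi> (a s) - ?p \<phi>) \<le> inverse (real (Suc (card s)))"
        by (rule filter_leD[OF U(1)])
    qed
    then have "((\<lambda>s. val M \<phi> (a s)) \<longlongrightarrow> ?p \<phi>) U"
      by (rule LIM_zero_cancel)
    moreover have "val M \<phi> (a s) = fm_val M \<phi> (\<lambda>v. assign x (a s) v)" for s
      using val_eq_assign[OF _ a, of \<phi> L s x] \<phi> by (simp add: affine_fms_def)
    ultimately show "((\<lambda>s. fm_val M \<phi> (\<lambda>v. assign x (a s) v)) \<longlongrightarrow> ?p \<phi>) U"
      by simp
  qed
qed

theorem corollary3p3:
  fixes L :: "('c, 'f, 'r) lang"
    and T :: "('c, 'f, 'r) cond set"
    and M :: "('c, 'f, 'r, 'm) struct"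
    and n :: nat
  assumes "is_lang L"
    and "complete_theory TYPE('m) L T"
    and "models L M T"
  shows "(compact_space (mtopology_of (met M)) \<longrightarrow>
            (\<forall>p\<in>extreme_types TYPE('m) L T n. \<exists>a. realizes L T n M a p)) \<and>
         ((\<forall>q\<in>cl_types TYPE(('c, 'f, 'r, 'm) universe) L (cl_theory L M) n.
             \<exists>a\<in>tuples M n. cl_tp L n M a = q) \<longrightarrow>
            (\<forall>p\<in>extreme_types TYPE('m) L T n. \<exists>a. realizes L T n M a p))"
proof (intro conjI impI ballI)
  fix p assume cpt: "compact_space (mtopology_of (met M))" and p: "p \<in> extreme_types TYPE('m) L T n"
  obtain U :: "('c, 'f, 'r) fm set filter" and e where U: "ultrafilter U"
    and "filterlim card at_top U"
    and e: "\<And>v s. e v s \<in> mspace (met M)"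
    and lim: "\<And>\<phi>. \<phi> \<in> affine_fms L n \<Longrightarrow>
      ((\<lambda>s. fm_val M \<phi> (\<lambda>v. e v s)) \<longlongrightarrow> p (fm_class TYPE('m) L T n \<phi>)) U"
    by (rule extreme_type_ultralimit[OF assms(2,3) p]) (rule that)
  interpret ultrapower L M U
    using U assms(3) by (simp add: ultrapower_def models_def)
  have ep: "e v \<in> pts" for v
    using e by (simp add: pts_def)
  have "\<exists>l\<in>mspace (met M). udist (e v) (\<lambda>_. l) = 0" for v
    by (rule compact_near_constant[OF cpt ep])
  then obtain l where l: "\<And>v. l v \<in> mspace (met M)" "\<And>v. udist (e v) (\<lambda>_. l v) = 0"
    by metis
  then have lp: "(\<lambda>_. l v) \<in> pts" for v
    by (simp add: pts_def)
  have cls: "cls (e v) = cls (\<lambda>_. l v)" for v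
    using l(2) by (simp add: cls_eq_iff ep lp)
  let ?a = "map l [0..<n]"
  have "p (fm_class TYPE('m) L T n \<phi>) = val M \<phi> ?a" if \<phi>: "\<phi> \<in> affine_fms L n" for \<phi>
  proof -
    have in_L: "fm_in L \<phi>"
      using \<phi> by (simp add: affine_fms_def cl_fms_def)
    have "((\<lambda>s. fm_val M \<phi> (\<lambda>v. e v s)) \<longlongrightarrow> fm_val upower \<phi> (\<lambda>v. cls (\<lambda>_. l v))) U"
      using los[OF in_L ep] by (simp add: cls)
    then have "p (fm_class TYPE('m) L T n \<phi>) = fm_val upower \<phi> (\<lambda>v. cls (\<lambda>_. l v))"
      by (rule tendsto_unique[OF nontriv lim[OF \<phi>]])
    moreover have "fm_val M \<phi> l = fm_val upower \<phi> (\<lambda>v. cls (\<lambda>_. l v))"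
      by (rule tendsto_unique[OF nontriv tendsto_const los[OF in_L lp]])
    moreover have "val M \<phi> ?a = fm_val M \<phi> l"
      using \<phi> by (intro val_eq_fm_val) (auto simp: affine_fms_def)
    ultimately show ?thesis by simp
  qed
  then have "realizes L T n M ?a p"
    using l(1) by (auto simp: realizes_def tuples_def)
  then show "\<exists>a. realizes L T n M a p" ..
next
  fix p
  assume sat: "\<forall>q\<in>cl_types TYPE(('c, 'f, 'r, 'm) universe) L (cl_theory L M) n.
      \<exists>a\<in>tuples M n. cl_tp L n M a = q"
    and p: "p \<in> extreme_types TYPE('m) L T n"
  obtain U :: "('c, 'f, 'r) fm set filter" and e where U: "ultrafilter U"
    and card: "filterlim card at_top U"
    and e: "\<And>v s. e v s \<in> mspace (met M)"
    and lim: "\<And>\<phi>. \<phi> \<in> affine_fms L n \<Longrightarrow>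
      ((\<lambda>s. fm_val M \<phi> (\<lambda>v. e v s)) \<longlongrightarrow> p (fm_class TYPE('m) L T n \<phi>)) U"
    by (rule extreme_type_ultralimit[OF assms(2,3) p]) (rule that)
  interpret ultrapower L M U
    using U assms(3) by (simp add: ultrapower_def models_def)
  have ep: "e v \<in> pts" for v
    using e by (simp add: pts_def)
  have sent: "val upower \<phi> [] = val M \<phi> []" if \<phi>: "\<phi> \<in> cl_fms L 0" for \<phi>
  proof -
    obtain x where x: "x \<in> mspace (met M)"
      using e by blast
    have "((\<lambda>s. fm_val M \<phi> (\<lambda>v. x)) \<longlongrightarrow> fm_val upower \<phi> (\<lambda>v. cls (\<lambda>_. x))) U"
      using \<phi> x by (intro los) (auto simp: cl_fms_def pts_def)
    then have "fm_val M \<phi> (\<lambda>v. x) = fm_val upower \<phi> (\<lambda>v. cls (\<lambda>_. x))"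
      by (rule tendsto_unique[OF nontriv tendsto_const])
    moreover have "val M \<phi> [] = fm_val M \<phi> (\<lambda>v. x)"
      "val upower \<phi> [] = fm_val upower \<phi> (\<lambda>v. cls (\<lambda>_. x))"
      using \<phi> by (auto intro!: val_eq_fm_val)
    ultimately show ?thesis
      by simp
  qed
  \<comment> \<open>The realization of \<open>p\<close> in the ultrapower, whose CL type is pulled back to \<open>M\<close>.\<close>
  let ?b = "map (\<lambda>v. cls (e v)) [0..<n]"
  have "models L upower (cl_theory L M)"
    using is_struct_upower[OF card] sent by (auto simp: models_def cl_theory_def)
  moreover have b: "?b \<in> tuples upower n"
    using ep by (auto simp: tuples_def mspace_upower)
  ultimately have "cl_tp L n upower ?b \<in> cl_types TYPE(('c, 'f, 'r, 'm) universe) L (cl_theory L M) n"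
    unfolding cl_types_def by blast
  then obtain a where a: "a \<in> tuples M n" "cl_tp L n M a = cl_tp L n upower ?b"
    using sat by blast
  have "p (fm_class TYPE('m) L T n \<phi>) = val M \<phi> a" if \<phi>: "\<phi> \<in> affine_fms L n" for \<phi>
  proof -
    let ?r = "p (fm_class TYPE('m) L T n \<phi>)"
    have \<phi>': "\<phi> \<in> cl_fms L n" "fm_in L \<phi>"
      using \<phi> by (simp_all add: affine_fms_def cl_fms_def)
    have "fm_val upower \<phi> (\<lambda>v. cls (e v)) = ?r"
      by (rule tendsto_unique[OF nontriv los[OF \<phi>'(2) ep] lim[OF \<phi>]])
    moreover have "val upower \<phi> ?b = fm_val upower \<phi> (\<lambda>v. cls (e v))"
      using \<phi>' by (intro val_eq_fm_val) auto
    ultimately have "(\<phi>, FReal ?r) \<in> cl_tp L n upower ?b" "(FReal ?r, \<phi>) \<in> cl_tp L n upower ?b"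
      using \<phi>' by (auto simp: cl_tp_def cl_fms_def val_def)
    then have "(\<phi>, FReal ?r) \<in> cl_tp L n M a" "(FReal ?r, \<phi>) \<in> cl_tp L n M a"
      using a(2) by simp_all
    then show ?thesis
      by (simp add: cl_tp_def val_def)
  qed
  then have "realizes L T n M a p"
    using a(1) by (auto simp: realizes_def)
  then show "\<exists>a. realizes L T n M a p" ..
qed

end
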